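(* Let $G=(V(G),E(G))$ be a finite graph. (1) Let $\psi:\{+,-\}^2\to(0,\infty)$ be symmetric and $\overline\psi:\{+,-\}\to(0,\infty)$, and suppose that $\frac{\psi(+,+)\psi(-,-)}{\psi(+,-)^2}\ge 1$. Then $$Z_G(\psi,\overline\psi)\ge Z_B(G),$$ where $Z_B(G)$ is the Bethe partition function associated with $(\psi,\overline\psi)$. (2) As a result, for every $q\ge2$, $w\ge 0$ and $B\ge0$, also $$Z_G(q,w,B)\ge Z_B(G),$$ where now $Z_B(G)$ is the Bethe partition function associated with $\psi(+,+)=1+w$, $\psi(+,-)=\psi(-,+)=1$, $\psi(-,-)=1+\frac{w}{q-1}$, $\overline\psi(+)=1$, $\overline\psi(-)=(q-1)e^{-B}$.
   Context: The two-spin partition function is $$Z_G(\psi,\overline\psi)=\sum_{\sigma\in\{+,-\}^{V(G)}}\ \prod_{v\in V(G)}\overline\psi(\sigma_v)\prod_{\{u,v\}\in E(G)}\psi(\sigma_u,\sigma_v).$$ The Bethe partition function associated with $(\psi,\overline\psi)$ is $Z_B(G)=\max_\mu Z_B(G,\mu)$, where $$\log Z_B(G,\mu)=\sum_{v\in V(G)}\sum_{\sigma}\mu_v(\sigma)\log\overline\psi(\sigma)+\sum_{\{u,v\}\in E(G)}\sum_{\sigma,\sigma'}\mu_{\{u,v\}}(\sigma,\sigma')\log\psi(\sigma,\sigma')-\sum_{v\in V(G)}\sum_\sigma\mu_v(\sigma)\log\mu_v(\sigma)-\sum_{\{u,v\}\in E(G)}\sum_{\sigma,\sigma'}\mu_{\{u,v\}}(\sigma,\sigma')\log\Big(\frac{\mu_{\{u,v\}}(\sigma,\sigma')}{\mu_u(\sigma)\mu_v(\sigma')}\Big)$$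 (sums over $\sigma,\sigma'\in\{+,-\}$, with $0\log 0=0$ conventions), and the maximum is over all families $\mu=\big((\mu_v(\sigma))_{v,\sigma},(\mu_e(\sigma,\sigma'))_{e,\sigma,\sigma'}\big)$ of nonnegative numbers with consistent marginals: $\sum_\sigma\mu_v(\sigma)=1$ for every $v\in V(G)$, and for every edge $\{u,v\}$ (first argument referring to $u$, second to $v$) $\sum_{\sigma}\mu_{\{u,v\}}(\sigma,\sigma')=\mu_v(\sigma')$ for all $\sigma'$ and $\sum_{\sigma'}\mu_{\{u,v\}}(\sigma,\sigma')=\mu_u(\sigma)$ for all $\sigma$. For $\omega\in\{0,1\}^{E(G)}$, $\mathscr C(\omega)$ is the collection of connected components of $(V(G),\{e:\omega_e=1\})$ (isolated vertices are components), $|C|$ is the number of vertices of $C$, and $$Z_G(q,w,B)=\sum_{\omega\in\{0,1\}^{E(G)}}\prod_{e\in E(G)}w^{\omega_e}\prod_{C\in\mathscr C(\omega)}\big(1+(q-1)e^{-B|C|}\big).$$ *)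

theory Defs
  imports "HOL-Analysis.Analysis" "HOL-Real_Asymp.Real_Asymp"
begin

datatype spin = Plus | Minus

lemma UNIV_spin: "UNIV = {Plus, Minus}"
  using spin.exhaust by auto

instance spin :: finite
  by standard (simp add: UNIV_spin)

definition finite_simple_graph :: "'a set \<Rightarrow> 'a set set \<Rightarrow> bool" where
  "finite_simple_graph V E \<longleftrightarrow>
     finite V \<and> (\<forall>e\<in>E. \<exists>u v. u \<in> V \<and> v \<in> V \<and> u \<noteq> v \<and> e = {u, v})"

text \<open>
  Edges are unordered pairs, whereas \<open>\<psi> (\<sigma> u) (\<sigma> v)\<close> and the edge marginal of \<open>{u, v}\<close> take
  their two arguments in an order.  We fix for every edge one (arbitrary) naming of its
  two endpoints: the first argument refers to \<open>fst (ends e)\<close>, the second to \<open>snd (ends e)\<close>.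
  For symmetric \<open>\<psi>\<close> nothing depends on this choice, see \<open>ends_sym\<close> below.
\<close>

definition ends :: "'a set \<Rightarrow> 'a \<times> 'a" where
  "ends e = (SOME p. e = {fst p, snd p})"

abbreviation src :: "'a set \<Rightarrow> 'a" where "src e \<equiv> fst (ends e)"
abbreviation tgt :: "'a set \<Rightarrow> 'a" where "tgt e \<equiv> snd (ends e)"

definition two_spin_Z ::
    "'a set \<Rightarrow> 'a set set \<Rightarrow> (spin \<Rightarrow> spin \<Rightarrow> real) \<Rightarrow> (spin \<Rightarrow> real) \<Rightarrow> real" where
  "two_spin_Z V E \<psi> \<psi>' =
     (\<Sum>\<sigma>\<in>V \<rightarrow>\<^sub>E UNIV. (\<Prod>v\<in>V. \<psi>' (\<sigma> v)) * (\<Prod>e\<in>E. \<psi> (\<sigma> (src e)) (\<sigma> (tgt e))))"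

text \<open>
  The families \<open>\<mu>\<close> with consistent marginals; values of \<open>\<mu>V\<close> off \<open>V\<close> and of \<open>\<mu>E\<close> off \<open>E\<close>
  are unconstrained and never used.
\<close>

definition local_marginals ::
    "'a set \<Rightarrow> 'a set set \<Rightarrow> (('a \<Rightarrow> spin \<Rightarrow> real) \<times> ('a set \<Rightarrow> spin \<Rightarrow> spin \<Rightarrow> real)) set" where
  "local_marginals V E = {(\<mu>V, \<mu>E).
     (\<forall>v\<in>V. \<forall>s. 0 \<le> \<mu>V v s) \<and>
     (\<forall>e\<in>E. \<forall>s t. 0 \<le> \<mu>E e s t) \<and>
     (\<forall>v\<in>V. (\<Sum>s\<in>UNIV. \<mu>V v s) = 1) \<and>
     (\<forall>e\<in>E. \<forall>t. (\<Sum>s\<in>UNIV. \<mu>E e s t) = \<mu>V (tgt e) t) \<and>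
     (\<forall>e\<in>E. \<forall>s. (\<Sum>t\<in>UNIV. \<mu>E e s t) = \<mu>V (src e) s)}"

text \<open>
  The conventions for \<open>0 log 0\<close> hold since \<open>ln\<close> and \<open>/\<close> are total and \<open>0 * x = 0\<close>; consistency
  of the marginals makes \<open>\<mu>E e s t = 0\<close> whenever the denominator vanishes.
\<close>

definition log_bethe ::
    "'a set \<Rightarrow> 'a set set \<Rightarrow> (spin \<Rightarrow> spin \<Rightarrow> real) \<Rightarrow> (spin \<Rightarrow> real) \<Rightarrow>
     ('a \<Rightarrow> spin \<Rightarrow> real) \<Rightarrow> ('a set \<Rightarrow> spin \<Rightarrow> spin \<Rightarrow> real) \<Rightarrow> real" where
  "log_bethe V E \<psi> \<psi>' \<mu>V \<mu>E =
     (\<Sum>v\<in>V. \<Sum>s\<in>UNIV. \<mu>V v s * ln (\<psi>' s))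
   + (\<Sum>e\<in>E. \<Sum>s\<in>UNIV. \<Sum>t\<in>UNIV. \<mu>E e s t * ln (\<psi> s t))
   - (\<Sum>v\<in>V. \<Sum>s\<in>UNIV. \<mu>V v s * ln (\<mu>V v s))
   - (\<Sum>e\<in>E. \<Sum>s\<in>UNIV. \<Sum>t\<in>UNIV.
        \<mu>E e s t * ln (\<mu>E e s t / (\<mu>V (src e) s * \<mu>V (tgt e) t)))"

text \<open>The maximum exists on every finite graph, see \<open>bethe_Z_attained\<close> below.\<close>

definition bethe_Z ::
    "'a set \<Rightarrow> 'a set set \<Rightarrow> (spin \<Rightarrow> spin \<Rightarrow> real) \<Rightarrow> (spin \<Rightarrow> real) \<Rightarrow> real" where
  "bethe_Z V E \<psi> \<psi>' =
     (GREATEST z. \<exists>(\<mu>V, \<mu>E)\<in>local_marginals V E. z = exp (log_bethe V E \<psi> \<psi>' \<mu>V \<mu>E))"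

definition components :: "'a set \<Rightarrow> 'a set set \<Rightarrow> 'a set set" where
  "components V F = V // {(u, v). u \<in> V \<and> v \<in> V \<and> (u, v) \<in> {(x, y). {x, y} \<in> F}\<^sup>*}"

definition random_cluster_Z ::
    "'a set \<Rightarrow> 'a set set \<Rightarrow> real \<Rightarrow> real \<Rightarrow> real \<Rightarrow> real" where
  "random_cluster_Z V E q w B =
     (\<Sum>\<omega>\<in>E \<rightarrow>\<^sub>E {0, 1::nat}.
        (\<Prod>e\<in>E. w ^ \<omega> e) *
        (\<Prod>C\<in>components V {e\<in>E. \<omega> e = 1}. 1 + (q - 1) * exp (- B * real (card C))))"

fun rc_psi :: "real \<Rightarrow> real \<Rightarrow> spin \<Rightarrow> spin \<Rightarrow> real" where
  "rc_psi q w Plus Plus = 1 + w"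
| "rc_psi q w Plus Minus = 1"
| "rc_psi q w Minus Plus = 1"
| "rc_psi q w Minus Minus = 1 + w / (q - 1)"

fun rc_psi_vertex :: "real \<Rightarrow> real \<Rightarrow> spin \<Rightarrow> real" where
  "rc_psi_vertex q B Plus = 1"
| "rc_psi_vertex q B Minus = (q - 1) * exp (- B)"


lemma ends_eq:
  assumes "e = {u, v}"
  shows "e = {src e, tgt e}"
proof -
  have "e = {fst (u, v), snd (u, v)}" using assms by simp
  then have "e = {fst (SOME p. e = {fst p, snd p}), snd (SOME p. e = {fst p, snd p})}"
    by (rule someI[where P = "\<lambda>p. e = {fst p, snd p}"])
  then show ?thesis unfolding ends_def .
qed

lemma ends_sym:
  assumes "\<And>x y. f x y = f y x" and "e = {u, v}"
  shows "f (src e) (tgt e) = f u v"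
proof -
  have "{src e, tgt e} = {u, v}" using ends_eq[OF assms(2)] assms(2) by (rule trans[OF sym])
  then have "src e = u \<and> tgt e = v \<or> src e = v \<and> tgt e = u" by (simp add: doubleton_eq_iff)
  then show ?thesis using assms(1)[of u v] by auto
qed

lemma ends_in_graph:
  assumes "finite_simple_graph V E" and "e \<in> E"
  shows "e = {src e, tgt e}" "src e \<in> V" "tgt e \<in> V" "src e \<noteq> tgt e"
proof -
  obtain u v where uv: "u \<in> V" "v \<in> V" "u \<noteq> v" "e = {u, v}"
    using assms unfolding finite_simple_graph_def by blast
  show eq: "e = {src e, tgt e}" using ends_eq[OF uv(4)] .
  have "{src e, tgt e} = {u, v}" using ends_eq[OF uv(4)] uv(4) by (rule trans[OF sym])
  then have ends: "src e \<in> {u, v}" "tgt e \<in> {u, v}" "u \<in> {src e, tgt e}" "v \<in> {src e, tgt e}"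
    by blast+
  show "src e \<in> V" using ends(1) uv(1,2) by auto
  show "tgt e \<in> V" using ends(2) uv(1,2) by auto
  show "src e \<noteq> tgt e" using ends(3,4) uv(3) by force
qed

lemma finite_edges:
  assumes "finite_simple_graph V E"
  shows "finite E"
proof -
  have "e \<subseteq> V" if "e \<in> E" for e
  proof -
    have "{src e, tgt e} \<subseteq> V" using ends_in_graph(2,3)[OF assms that] by simp
    then show ?thesis using ends_in_graph(1)[OF assms that] by (rule ssubst[rotated])
  qed
  then have "E \<subseteq> Pow V" by (simp add: subset_iff)
  moreover have "finite (Pow V)" using assms by (simp add: finite_simple_graph_def)
  ultimately show ?thesis by (rule finite_subset)
qed

lemma continuous_on_x_ln_x: "continuous_on {0..} (\<lambda>x::real. x * ln x)"
  unfolding continuous_on_def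
proof
  fix x :: real assume x: "x \<in> {0..}"
  show "((\<lambda>x. x * ln x) \<longlongrightarrow> x * ln x) (at x within {0..})"
  proof (cases "x = 0")
    case True
    have "((\<lambda>x::real. x * ln x) \<longlongrightarrow> 0) (at_right 0)" by real_asymp
    then have "((\<lambda>x::real. x * ln x) \<longlongrightarrow> 0) (at 0 within {0..})"
      by (simp add: at_within_Ici_at_right)
    then show ?thesis using True by simp
  next
    case False
    with x have "isCont (\<lambda>x. x * ln x) x" by (intro continuous_intros) auto
    then show ?thesis 
      unfolding isCont_def by (rule tendsto_within_subset) simp
  qed
qed

lemma log_bethe_expand:
  assumes G: "finite_simple_graph V E" and M: "(m, n) \<in> local_marginals V E"
  shows "log_bethe V E \<psi> \<psi>' m n =
     (\<Sum>v\<in>V. \<Sum>s\<in>UNIV. m v s * ln (\<psi>' s))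
   + (\<Sum>e\<in>E. \<Sum>s\<in>UNIV. \<Sum>t\<in>UNIV. n e s t * ln (\<psi> s t))
   - (\<Sum>v\<in>V. \<Sum>s\<in>UNIV. m v s * ln (m v s))
   - (\<Sum>e\<in>E. (\<Sum>s\<in>UNIV. \<Sum>t\<in>UNIV. n e s t * ln (n e s t))
        - (\<Sum>s\<in>UNIV. m (src e) s * ln (m (src e) s))
        - (\<Sum>t\<in>UNIV. m (tgt e) t * ln (m (tgt e) t)))"
proof -
  have "(\<Sum>s\<in>UNIV. \<Sum>t\<in>UNIV. n e s t * ln (n e s t / (m (src e) s * m (tgt e) t))) =
      (\<Sum>s\<in>UNIV. \<Sum>t\<in>UNIV. n e s t * ln (n e s t))
        - (\<Sum>s\<in>UNIV. m (src e) s * ln (m (src e) s))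
        - (\<Sum>t\<in>UNIV. m (tgt e) t * ln (m (tgt e) t))" if e: "e \<in> E" for e
  proof -
    have nn: "0 \<le> n e s t" for s t using M e by (auto simp: local_marginals_def)
    have col: "(\<Sum>s\<in>UNIV. n e s t) = m (tgt e) t" for t
      using M e by (auto simp: local_marginals_def)
    have row: "(\<Sum>t\<in>UNIV. n e s t) = m (src e) s" for s
      using M e by (auto simp: local_marginals_def)
    have term_eq: "n e s t * ln (n e s t / (m (src e) s * m (tgt e) t)) =
        n e s t * ln (n e s t) - n e s t * ln (m (src e) s) - n e s t * ln (m (tgt e) t)" for s t
    proof (cases "n e s t = 0")
      case False
      then have p: "0 < n e s t" using nn[of s t] by simp
      have "n e s t \<le> m (src e) s" unfolding row[symmetric]
        by (rule member_le_sum) (auto simp: nn)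
      moreover have "n e s t \<le> m (tgt e) t" unfolding col[symmetric]
        by (rule member_le_sum[where f = "\<lambda>s. n e s t"]) (auto simp: nn)
      ultimately have "0 < m (src e) s" "0 < m (tgt e) t" using p by linarith+
      then show ?thesis using p by (simp add: ln_div ln_mult algebra_simps)
    qed simp
    have "(\<Sum>s\<in>UNIV. \<Sum>t\<in>UNIV. n e s t * ln (m (tgt e) t)) =
        (\<Sum>t\<in>UNIV. \<Sum>s\<in>UNIV. n e s t * ln (m (tgt e) t))" by (rule sum.swap)
    also have "\<dots> = (\<Sum>t\<in>UNIV. m (tgt e) t * ln (m (tgt e) t))"
      by (simp add: sum_distrib_right[symmetric] col)
    finally have c: "(\<Sum>s\<in>UNIV. \<Sum>t\<in>UNIV. n e s t * ln (m (tgt e) t)) = \<dots>" .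
    have r: "(\<Sum>s\<in>UNIV. \<Sum>t\<in>UNIV. n e s t * ln (m (src e) s)) =
        (\<Sum>s\<in>UNIV. m (src e) s * ln (m (src e) s))"
      by (simp add: sum_distrib_right[symmetric] row)
    show ?thesis by (simp add: term_eq sum_subtractf c r)
  qed
  then show ?thesis unfolding log_bethe_def by simp
qed

lemma log_bethe_cong:
  assumes G: "finite_simple_graph V E"
    and "\<And>v. v \<in> V \<Longrightarrow> m v = m' v" and "\<And>e. e \<in> E \<Longrightarrow> n e = n' e"
  shows "log_bethe V E \<psi> \<psi>' m n = log_bethe V E \<psi> \<psi>' m' n'"
    and "(m, n) \<in> local_marginals V E \<longleftrightarrow> (m', n') \<in> local_marginals V E"
  by (simp_all add: log_bethe_def local_marginals_def assms(2,3) ends_in_graph(2,3)[OF G]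
      cong: sum.cong)

theorem bethe_Z_attained:
  fixes V :: "'a set" and E :: "'a set set"
  assumes G: "finite_simple_graph V E"
  shows "\<exists>(m, n)\<in>local_marginals V E. bethe_Z V E \<psi> \<psi>' = exp (log_bethe V E \<psi> \<psi>' m n)"
    and "(m, n) \<in> local_marginals V E \<Longrightarrow> exp (log_bethe V E \<psi> \<psi>' m n) \<le> bethe_Z V E \<psi> \<psi>'"
proof -
  define mV where "mV = (\<lambda>(x :: ('a \<times> spin) + ('a set \<times> spin \<times> spin) \<Rightarrow> real) v s. x (Inl (v, s)))"
  define mE where "mE = (\<lambda>(x :: ('a \<times> spin) + ('a set \<times> spin \<times> spin) \<Rightarrow> real) e s t. x (Inr (e, s, t)))"
  define K where "K = {x. (mV x, mE x) \<in> local_marginals V E} \<inter> (UNIV \<rightarrow>\<^sub>E {0..1})"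
  have coord: "continuous_on A (\<lambda>x. x i)"
    for A :: "(('a \<times> spin) + ('a set \<times> spin \<times> spin) \<Rightarrow> real) set" and i
    by (rule continuous_on_product_then_coordinatewise) (rule continuous_on_id)
  have "compactin (product_topology (\<lambda>i::('a \<times> spin) + ('a set \<times> spin \<times> spin). euclidean) UNIV)
          (UNIV \<rightarrow>\<^sub>E {0..1::real})"
    by (simp add: compactin_PiE compactin_euclidean_iff)
  then have box: "compact (UNIV \<rightarrow>\<^sub>E {0..1::real}
      :: (('a \<times> spin) + ('a set \<times> spin \<times> spin) \<Rightarrow> real) set)"
    by (simp add: euclidean_product_topology compactin_euclidean_iff)
  have cl: "closed {x. (mV x, mE x) \<in> local_marginals V E}"
  proof -
    have ball: "closed {x. \<forall>i\<in>I. P i x}" if "\<And>i. i \<in> I \<Longrightarrow> closed {x. P i x}"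
      for I :: "'c set" and P :: "'c \<Rightarrow> (('a \<times> spin) + ('a set \<times> spin \<times> spin) \<Rightarrow> real) \<Rightarrow> bool"
      using closed_INT[of I "\<lambda>i. {x. P i x}"] that by (simp add: Collect_ball_eq)
    show ?thesis
      unfolding local_marginals_def mV_def mE_def case_prod_conv mem_Collect_eq
      by (intro closed_Collect_conj ball closed_Collect_all closed_Collect_le
          closed_Collect_eq continuous_on_sum continuous_on_const coord)
  qed
  have compK: "compact K" unfolding K_def using closed_Int_compact[OF cl box] .
  have K_marg: "(mV x, mE x) \<in> local_marginals V E" if "x \<in> K" for x
    using that by (simp add: K_def)
  have K_nn: "0 \<le> x i" if "x \<in> K" for x i using that by (auto simp: K_def PiE_iff)
  have xlnx: "continuous_on K (\<lambda>x. x i * ln (x i))" for i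
    by (rule continuous_on_compose2[OF continuous_on_x_ln_x coord]) (use K_nn in auto)
  have cont: "continuous_on K (\<lambda>x. log_bethe V E \<psi> \<psi>' (mV x) (mE x))"
  proof -
    have "continuous_on K (\<lambda>x.
     (\<Sum>v\<in>V. \<Sum>s\<in>UNIV. mV x v s * ln (\<psi>' s))
   + (\<Sum>e\<in>E. \<Sum>s\<in>UNIV. \<Sum>t\<in>UNIV. mE x e s t * ln (\<psi> s t))
   - (\<Sum>v\<in>V. \<Sum>s\<in>UNIV. mV x v s * ln (mV x v s))
   - (\<Sum>e\<in>E. (\<Sum>s\<in>UNIV. \<Sum>t\<in>UNIV. mE x e s t * ln (mE x e s t))
        - (\<Sum>s\<in>UNIV. mV x (src e) s * ln (mV x (src e) s))
        - (\<Sum>t\<in>UNIV. mV x (tgt e) t * ln (mV x (tgt e) t))))"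
      unfolding mV_def mE_def
      by (intro continuous_on_add continuous_on_diff continuous_on_sum xlnx
          continuous_on_mult_right coord)
    then show ?thesis
      by (rule continuous_on_eq) (simp add: log_bethe_expand[OF G K_marg])
  qed
  have lift: "\<exists>x\<in>K. log_bethe V E \<psi> \<psi>' (mV x) (mE x) = log_bethe V E \<psi> \<psi>' m n"
    if M: "(m, n) \<in> local_marginals V E" for m n
  proof -
    define x where "x = (\<lambda>i. case i of Inl (v, s) \<Rightarrow> if v \<in> V then m v s else 0
        | Inr (e, s, t) \<Rightarrow> if e \<in> E then n e s t else 0)"
    have V1: "v \<in> V \<Longrightarrow> mV x v = m v" and E1: "e \<in> E \<Longrightarrow> mE x e = n e" for v e
      by (auto simp: mV_def mE_def x_def)
    have m01: "0 \<le> m v s \<and> m v s \<le> 1" if "v \<in> V" for v s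
    proof -
      have "m v s \<le> (\<Sum>s\<in>UNIV. m v s)"
        by (rule member_le_sum) (use M that in \<open>auto simp: local_marginals_def\<close>)
      then show ?thesis using M that by (auto simp: local_marginals_def)
    qed
    have n01: "0 \<le> n e s t \<and> n e s t \<le> 1" if e: "e \<in> E" for e s t
    proof -
      have "n e s t \<le> (\<Sum>t\<in>UNIV. n e s t)"
        by (rule member_le_sum) (use M that in \<open>auto simp: local_marginals_def\<close>)
      also have "\<dots> = m (src e) s" using M e by (auto simp: local_marginals_def)
      also have "\<dots> \<le> 1" using m01[OF ends_in_graph(2)[OF G e]] by simp
      finally show ?thesis using M e by (auto simp: local_marginals_def)
    qed
    have "x \<in> UNIV \<rightarrow>\<^sub>E {0..1}"
      using m01 n01 by (auto simp: x_def PiE_iff split: sum.splits)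
    moreover have "(mV x, mE x) \<in> local_marginals V E"
      by (subst log_bethe_cong(2)[OF G, of "mV x" m "mE x" n]) (fact V1, fact E1, fact M)
    ultimately have "x \<in> K" by (simp add: K_def)
    moreover have "log_bethe V E \<psi> \<psi>' (mV x) (mE x) = log_bethe V E \<psi> \<psi>' m n"
      by (rule log_bethe_cong(1)[OF G]) (fact V1, fact E1)
    ultimately show ?thesis by blast
  qed
  have "((\<lambda>v s. 1/2), (\<lambda>e s t. 1/4)) \<in> local_marginals V E"
    by (auto simp: local_marginals_def UNIV_spin)
  then have "K \<noteq> {}" using lift by blast
  then obtain x where x: "x \<in> K"
    and max: "\<And>y. y \<in> K \<Longrightarrow> log_bethe V E \<psi> \<psi>' (mV y) (mE y) \<le> log_bethe V E \<psi> \<psi>' (mV x) (mE x)"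
    using continuous_attains_sup[OF compK _ cont] by blast
  have ub: "exp (log_bethe V E \<psi> \<psi>' m n) \<le> exp (log_bethe V E \<psi> \<psi>' (mV x) (mE x))"
    if "(m, n) \<in> local_marginals V E" for m n
    using lift[OF that] max by (metis exp_le_cancel_iff)
  have eq: "bethe_Z V E \<psi> \<psi>' = exp (log_bethe V E \<psi> \<psi>' (mV x) (mE x))"
    unfolding bethe_Z_def
    by (rule Greatest_equality) (use K_marg[OF x] ub in auto)
  show "\<exists>(m, n)\<in>local_marginals V E. bethe_Z V E \<psi> \<psi>' = exp (log_bethe V E \<psi> \<psi>' m n)"
    using eq K_marg[OF x] by blast
  show "(m, n) \<in> local_marginals V E \<Longrightarrow> exp (log_bethe V E \<psi> \<psi>' m n) \<le> bethe_Z V E \<psi> \<psi>'"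
    using ub eq by simp
qed

end

theory Submission
  imports Defs
begin

text \<open>
  For the first part, let \<open>(m, n)\<close> maximize the Bethe functional.  All entries of \<open>m\<close> and \<open>n\<close> are
  positive, because the entropy has infinite slope at the boundary.  Stationarity then shows that
  the weight of each configuration \<open>\<sigma>\<close> is the Bethe value times
  \<open>(\<Prod>v. m v (\<sigma> v)) * (\<Prod>e. f e (\<sigma> (src e)) (\<sigma> (tgt e)))\<close> with
  \<open>f e s t = n e s t / (m (src e) s * m (tgt e) t)\<close>, and that \<open>f\<close> has the same cross ratios as
  \<open>\<psi>\<close> (\<open>maximizer_reparametrization\<close>, \<open>maximizer_edge_determinant\<close>).  It remains to see that
  the sum of these products is at least 1: this is \<open>normalized_system_Z_ge_1\<close>, a statement about
  laws \<open>p v\<close> and factors \<open>f u v\<close> that average to 1 over either end and favour equal spins.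

  That statement is proved by induction on the number of vertices.  Clamping a vertex \<open>i\<close> to the
  spin \<open>s\<close> multiplies the laws of the other vertices by the tilts \<open>f i v s\<close>, which have mean 1 and
  all favour \<open>s\<close>.  Belief propagation started from the untilted fixed point moves monotonically
  towards \<open>s\<close>, and the Bethe value, which is 1 at the start, does not decrease on the way
  (\<open>bp_fixed_point_exists\<close>).  Rewriting the clamped system around the new fixed point gives a
  factor that is at least 1 times a smaller normalized system, to which the induction hypothesis
  applies.  So the system clamped to \<open>s\<close> contributes at least \<open>p i s\<close>, and the two
  contributions add up to at least 1.

  For the second part, expand \<open>rc_psi q w s t = 1 + w * mono_weight (q - 1) s t\<close> over edge
  subsets \<open>F\<close>.  The spins that contribute to \<open>F\<close> are constant on the components of \<open>F\<close>, and a set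
  of \<open>k\<close> components with \<open>N\<close> vertices and \<open>j\<close> edges carrying the minus spin contributes
  \<open>exp (- B * N)\<close> times \<open>(q - 1) ^ N / (q - 1) ^ j\<close>, which is at most \<open>(q - 1) ^ k\<close> because
  \<open>N \<le> j + k\<close> and \<open>q \<ge> 2\<close>.  Summing over the sets of components gives the product in the
  random-cluster weight of \<open>F\<close>; the first part applies to \<open>rc_psi\<close>.
\<close>

section \<open>Monotone belief propagation\<close>

lemma ratio_mono:
  fixes k a a' r b :: real
  assumes "0 \<le> k" "0 \<le> a" "a \<le> a'" "0 \<le> b" "b \<le> r"
  shows "(1 + k * a' * b) * (1 + k * a * r) \<le> (1 + k * a' * r) * (1 + k * a * b)"
proof -
  have "0 \<le> k * ((a' - a) * (r - b))" using assms by simp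
  then show ?thesis by (simp add: algebra_simps)
qed

text \<open>
  Belief propagation for a tilted normalized system, in coordinates.  One of the two spins is
  the distinguished (high) one; \<open>P v\<close> is the probability of the high spin under the normalized
  system, \<open>bp v\<close> and \<open>bm v\<close> are the tilted probabilities of the high and of the low spin, and
  the edge factor is \<open>1 + \<kappa> u v * x\<^sub>u * x\<^sub>v\<close>, where \<open>x\<^sub>v\<close> is \<open>1 - P v\<close> or \<open>- P v\<close>.  The number
  \<open>a (u, v)\<close> is the excess over \<open>P u\<close> of the cavity probability of the high spin at \<open>u\<close> when
  the influence of \<open>v\<close> is ignored, and \<open>Mp a u v\<close>, \<open>Mm a u v\<close> are the two values of the message
  from \<open>u\<close> to \<open>v\<close>.

  The lemma produces a fixed point at which the Bethe value
  \<open>(\<Prod>v. Z v) / sqrt (\<Prod>u. \<Prod>v. B u v)\<close> is at least 1.  Since the tilts favour the high spin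
  and the couplings favour equal spins, the update map is monotone.  Consider the \<open>a\<close> that lie
  below their own update and have Bethe value at least 1; \<open>a = 0\<close> is one of them.  Raising one
  coordinate to its updated value stays in this set: the numerator and the denominator of the
  Bethe value are affine in that coordinate, and the relative slope of the numerator is the
  larger one.  A point of this compact set with maximal coordinate sum is therefore fixed.
\<close>

lemma bp_fixed_point_exists:
  fixes V :: "'a set" and P bp bm :: "'a \<Rightarrow> real" and \<kappa> :: "'a \<Rightarrow> 'a \<Rightarrow> real"
  assumes fin: "finite V"
    and P: "\<And>v. v \<in> V \<Longrightarrow> 0 < P v" "\<And>v. v \<in> V \<Longrightarrow> P v < 1"
    and \<kappa>_nn: "\<And>u v. u \<in> V \<Longrightarrow> v \<in> V \<Longrightarrow> 0 \<le> \<kappa> u v"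
    and \<kappa>_sym: "\<And>u v. u \<in> V \<Longrightarrow> v \<in> V \<Longrightarrow> \<kappa> u v = \<kappa> v u"
    and \<kappa>_less: "\<And>u v. u \<in> V \<Longrightarrow> v \<in> V \<Longrightarrow> \<kappa> u v * (1 - P u) * P v < 1"
    and bp: "\<And>v. v \<in> V \<Longrightarrow> P v \<le> bp v" and bm: "\<And>v. v \<in> V \<Longrightarrow> 0 < bm v"
    and b1: "\<And>v. v \<in> V \<Longrightarrow> bp v + bm v = 1"
  defines "Mp \<equiv> \<lambda>a u v. 1 + \<kappa> u v * a (u, v) * (1 - P v)"
    and "Mm \<equiv> \<lambda>a u v. 1 - \<kappa> u v * a (u, v) * P v"
  defines "kp \<equiv> \<lambda>a u v. bp u * (\<Prod>w\<in>V - {v}. Mp a w u)"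
    and "km \<equiv> \<lambda>a u v. bm u * (\<Prod>w\<in>V - {v}. Mm a w u)"
    and "Z \<equiv> \<lambda>a v. bp v * (\<Prod>w\<in>V. Mp a w v) + bm v * (\<Prod>w\<in>V. Mm a w v)"
    and "B \<equiv> \<lambda>a u v. 1 + \<kappa> u v * a (u, v) * a (v, u)"
  shows "\<exists>a :: 'a \<times> 'a \<Rightarrow> real.
     (\<forall>u\<in>V. \<forall>v\<in>V. 0 \<le> a (u, v) \<and> a (u, v) \<le> 1 - P u)
   \<and> (\<forall>u\<in>V. \<forall>v\<in>V. u \<noteq> v \<longrightarrow> (P u + a (u, v)) * km a u v = (1 - P u - a (u, v)) * kp a u v)
   \<and> (\<Prod>u\<in>V. \<Prod>v\<in>V. B a u v) \<le> (\<Prod>v\<in>V. Z a v)\<^sup>2"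
proof -
  \<comment> \<open>Coordinates outside \<open>V \<times> V\<close> play no role; the box only keeps them bounded.\<close>
  define box where "box = (UNIV \<rightarrow>\<^sub>E {0..1::real} :: ('a \<times> 'a \<Rightarrow> real) set)"
  \<comment> \<open>The condition that \<open>a\<close> lies below its update is written without denominators, which makes
    it visibly closed.\<close>
  define D where "D = {a. (\<forall>u\<in>V. \<forall>v\<in>V. 0 \<le> a (u, v) \<and> a (u, v) \<le> 1 - P u
        \<and> (u \<noteq> v \<longrightarrow> (P u + a (u, v)) * km a u v \<le> (1 - P u - a (u, v)) * kp a u v))
        \<and> (\<Prod>u\<in>V. \<Prod>v\<in>V. B a u v) \<le> (\<Prod>v\<in>V. Z a v)\<^sup>2}"
  have coord: "continuous_on A (\<lambda>x. x i)" for A :: "('a \<times> 'a \<Rightarrow> real) set" and i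
    by (rule continuous_on_product_then_coordinatewise) (rule continuous_on_id)
  have "compactin (product_topology (\<lambda>i::'a \<times> 'a. euclidean) UNIV) (UNIV \<rightarrow>\<^sub>E {0..1::real})"
    by (simp add: compactin_PiE compactin_euclidean_iff)
  then have comp_box: "compact box"
    by (simp add: euclidean_product_topology compactin_euclidean_iff box_def)
  have closedD: "closed D"
  proof -
    have ball: "closed {x. \<forall>i\<in>I. Q i x}" if "\<And>i. i \<in> I \<Longrightarrow> closed {x. Q i x}"
      for I :: "'c set" and Q :: "'c \<Rightarrow> ('a \<times> 'a \<Rightarrow> real) \<Rightarrow> bool"
      using closed_INT[of I "\<lambda>i. {x. Q i x}"] that by (simp add: Collect_ball_eq)
    show ?thesis
      unfolding D_def Z_def B_def kp_def km_def Mp_def Mm_def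
      by (intro closed_Collect_conj ball closed_Collect_imp open_Collect_const closed_Collect_le
          continuous_intros coord)
  qed
  have compDK: "compact (D \<inter> box)" using closed_Int_compact[OF closedD comp_box] .
  have zero: "(\<lambda>_. 0) \<in> D \<inter> box"
  proof -
    have "P u * bm u \<le> (1 - P u) * bp u" if "u \<in> V" for u
    proof -
      have "P u * bm u \<le> P u * (1 - P u)" using bp[OF that] b1[OF that] P(1)[OF that] by simp
      also have "\<dots> \<le> (1 - P u) * bp u" using bp[OF that] P(2)[OF that] by simp
      finally show ?thesis .
    qed
    moreover have "(\<Prod>v\<in>V. bp v + bm v) = 1" using b1 by simp
    ultimately show ?thesis
      using P by (auto simp: D_def box_def kp_def km_def Mp_def Mm_def B_def Z_def less_imp_le)
  qed
  have "continuous_on (D \<inter> box) (\<lambda>a. \<Sum>i\<in>V\<times>V. a i)" by (intro continuous_intros coord)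
  then obtain a where aD: "a \<in> D" "a \<in> box"
    and amax: "\<And>c. c \<in> D \<Longrightarrow> c \<in> box \<Longrightarrow> (\<Sum>i\<in>V\<times>V. c i) \<le> (\<Sum>i\<in>V\<times>V. a i)"
    using continuous_attains_sup[OF compDK] zero by (metis (no_types, lifting) Int_iff empty_iff)
  have a0: "0 \<le> a (u, v)" and a1: "a (u, v) \<le> 1 - P u"
    and asub: "u \<noteq> v \<Longrightarrow> (P u + a (u, v)) * km a u v \<le> (1 - P u - a (u, v)) * kp a u v"
    if "u \<in> V" "v \<in> V" for u v
    using aD that by (auto simp: D_def)
  have aPhi: "(\<Prod>u\<in>V. \<Prod>v\<in>V. B a u v) \<le> (\<Prod>v\<in>V. Z a v)\<^sup>2" using aD by (simp add: D_def)
  have Mp1: "1 \<le> Mp c u v" and Mm0: "0 < Mm c u v"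
    if "u \<in> V" "v \<in> V" "0 \<le> c (u, v)" "c (u, v) \<le> 1 - P u" for c u v
  proof -
    show "1 \<le> Mp c u v" using that \<kappa>_nn P(2)[of v] by (simp add: Mp_def)
    have "\<kappa> u v * c (u, v) * P v \<le> \<kappa> u v * (1 - P u) * P v"
      using that \<kappa>_nn P(1)[of v] by (intro mult_right_mono mult_left_mono) (auto simp: less_imp_le)
    then show "0 < Mm c u v" using \<kappa>_less[OF that(1,2)] by (simp add: Mm_def)
  qed
  note Mp1a = Mp1[where c = a, OF _ _ a0 a1] and Mm0a = Mm0[where c = a, OF _ _ a0 a1]
  have bp0: "0 < bp v" if "v \<in> V" for v using bp[OF that] P(1)[OF that] by linarith
  have kp0: "0 < kp a u v" and km0: "0 < km a u v" if "u \<in> V" for u v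
    using that bp0 bm Mp1a Mm0a
    by (auto simp: kp_def km_def intro!: mult_pos_pos prod_pos) (meson less_le_trans zero_less_one)
  have "(P u + a (u, v)) * km a u v = (1 - P u - a (u, v)) * kp a u v"
    if u: "u \<in> V" and v: "v \<in> V" and uv: "u \<noteq> v" for u v
  proof (rule ccontr)
    assume "\<not> ?thesis"
    then have lt: "(P u + a (u, v)) * km a u v < (1 - P u - a (u, v)) * kp a u v"
      using asub[OF u v uv] by simp
    \<comment> \<open>\<open>y\<close> is the updated value of the coordinate \<open>(u, v)\<close>.\<close>
    define y where "y = kp a u v / (kp a u v + km a u v) - P u"
    define c where "c = a((u, v) := y)"
    have den: "0 < kp a u v + km a u v" using kp0[OF u, of v] km0[OF u, of v] by simp
    have y_gt: "a (u, v) < y"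
      using lt den by (simp add: y_def field_simps)
    have y1: "y \<le> 1 - P u"
      using den km0[OF u, of v] by (simp add: y_def field_simps)
    have y0: "0 \<le> y" using y_gt a0[OF u v] by linarith
    have yeq: "(P u + y) * km a u v = (1 - P u - y) * kp a u v"
      using den by (simp add: y_def field_simps)
    have c_ge: "a i \<le> c i" for i using y_gt by (simp add: c_def)
    have c0: "0 \<le> c (x, z)" and c1: "c (x, z) \<le> 1 - P x" if "x \<in> V" "z \<in> V" for x z
      using a0[OF that] a1[OF that] y0 y1 by (auto simp: c_def)
    have Mp_mono: "Mp a x z \<le> Mp c x z" and Mm_mono: "Mm c x z \<le> Mm a x z"
      if "x \<in> V" "z \<in> V" for x z
      using c_ge[of "(x, z)"] that \<kappa>_nn P[of z] unfolding Mp_def Mm_def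
      by (auto intro!: mult_right_mono mult_left_mono simp: less_imp_le)
    have kp_mono: "kp a x z \<le> kp c x z" if "x \<in> V" "z \<in> V" for x z
      unfolding kp_def using bp0[OF that(1)] that(1) Mp_mono Mp1a
      by (auto intro!: mult_left_mono prod_mono simp: less_imp_le)
         (meson DiffD1 order.trans zero_le_one)
    have km_mono: "km c x z \<le> km a x z" if "x \<in> V" "z \<in> V" for x z
      unfolding km_def using bm[OF that(1)] that(1) Mm_mono Mm0[where c = c, OF _ _ c0 c1]
      by (auto intro!: mult_left_mono prod_mono simp: less_imp_le)
    have k_uv: "kp c u v = kp a u v" "km c u v = km a u v"
      unfolding kp_def km_def Mp_def Mm_def using uv
      by (auto simp: c_def intro!: prod.cong)
    have sub: "(P x + c (x, z)) * km c x z \<le> (1 - P x - c (x, z)) * kp c x z"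
      if x: "x \<in> V" and z: "z \<in> V" and xz: "x \<noteq> z" for x z
    proof (cases "(x, z) = (u, v)")
      case True
      then show ?thesis using yeq k_uv by (simp add: c_def)
    next
      case False
      then have cx: "c (x, z) = a (x, z)" by (auto simp: c_def)
      have "(P x + c (x, z)) * km c x z \<le> (P x + a (x, z)) * km a x z"
        unfolding cx using km_mono[OF x z] P(1)[OF x] a0[OF x z] by (intro mult_left_mono) auto
      also have "\<dots> \<le> (1 - P x - a (x, z)) * kp a x z" using asub[OF x z xz] .
      also have "\<dots> \<le> (1 - P x - c (x, z)) * kp c x z"
        unfolding cx using kp_mono[OF x z] a1[OF x z] by (intro mult_left_mono) auto
      finally show ?thesis .
    qed
    have Phi: "(\<Prod>x\<in>V. \<Prod>z\<in>V. B c x z) \<le> (\<Prod>x\<in>V. Z c x)\<^sup>2"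
    proof -
      define K where "K = kp a v u + km a v u"
      define r where "r = kp a v u / K - P v"
      define k where "k = \<kappa> u v"
      have K0: "0 < K" using kp0[OF v, of u] km0[OF v, of u] by (simp add: K_def)
      have r_ge: "a (v, u) \<le> r"
        using asub[OF v u] uv K0 by (simp add: r_def K_def field_simps)
      have Zsplit: "Z d v = kp d v u * Mp d u v + km d v u * Mm d u v" for d
        unfolding Z_def kp_def km_def using prod.remove[OF fin u, of "\<lambda>w. Mp d w v"]
          prod.remove[OF fin u, of "\<lambda>w. Mm d w v"] by simp
      \<comment> \<open>The cavity weights at \<open>v\<close> omit the message from \<open>u\<close>, so they do not change.\<close>
      have k_vu: "kp c v u = kp a v u" "km c v u = km a v u"
        unfolding kp_def km_def Mp_def Mm_def by (auto simp: c_def intro!: prod.cong)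
      have kpr: "kp a v u = K * (P v + r)" "km a v u = K * (1 - P v - r)"
        using K0 by (auto simp: r_def K_def field_simps)
      have Zform: "Z d v = K * (1 + k * d (u, v) * r)"
        if "kp d v u = kp a v u" "km d v u = km a v u" for d
        unfolding Zsplit that kpr Mp_def Mm_def k_def by (simp add: algebra_simps)
      have Zcv: "Z c v = K * (1 + k * y * r)" using Zform[OF k_vu] by (simp add: c_def)
      have Zav: "Z a v = K * (1 + k * a (u, v) * r)" using Zform[OF refl refl] .
      have Zother: "Z c x = Z a x" if "x \<noteq> v" for x
        unfolding Z_def Mp_def Mm_def using that by (auto simp: c_def)
      have k0: "0 \<le> k" using \<kappa>_nn[OF u v] by (simp add: k_def)
      have au: "0 \<le> a (u, v)" and av: "0 \<le> a (v, u)" using a0 u v by auto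
      \<comment> \<open>The factor by which the raised coordinate changes both \<open>B u v\<close> and \<open>B v u\<close>; it is at
        most the factor gained by \<open>Z v\<close>, which is what \<open>ratio_mono\<close> says.\<close>
      define \<rho> where "\<rho> = (1 + k * y * a (v, u)) / (1 + k * a (u, v) * a (v, u))"
      have dpos: "0 < 1 + k * a (u, v) * a (v, u)" and dpos': "0 < 1 + k * a (u, v) * r"
        using k0 au av r_ge by (auto intro!: add_pos_nonneg mult_nonneg_nonneg)
      have \<rho>0: "0 \<le> \<rho>" using k0 y0 av dpos unfolding \<rho>_def by (auto intro!: divide_nonneg_pos)
      have Bc: "B c x z = B a x z * (if (x, z) = (u, v) then \<rho> else 1) * (if (x, z) = (v, u) then \<rho> else 1)"
        if "x \<in> V" "z \<in> V" for x z
      proof (cases "(x, z) = (u, v) \<or> (x, z) = (v, u)")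
        case True
        have "1 + k * y * a (v, u) = (1 + k * a (u, v) * a (v, u)) * \<rho>"
          using dpos by (simp add: \<rho>_def)
        moreover have "B c u v = 1 + k * y * a (v, u)" "B a u v = 1 + k * a (u, v) * a (v, u)"
          using uv by (simp_all add: B_def c_def k_def)
        moreover have "B c v u = 1 + k * y * a (v, u)" "B a v u = 1 + k * a (u, v) * a (v, u)"
          unfolding B_def \<kappa>_sym[OF v u] using uv by (simp_all add: c_def k_def)
        ultimately have "B c u v = B a u v * \<rho>" "B c v u = B a v u * \<rho>" by metis+
        then show ?thesis using True uv by (elim disjE) simp_all
      next
        case False
        then have "(u, v) \<noteq> (x, z)" "(u, v) \<noteq> (z, x)" by blast+
        then have "c (x, z) = a (x, z)" "c (z, x) = a (z, x)"
          unfolding c_def by (auto simp only: fun_upd_apply split: if_split)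
        then have "B c x z = B a x z" by (simp only: B_def)
        moreover have "((x, z) = (u, v)) = False" "((x, z) = (v, u)) = False" using False by blast+
        ultimately show ?thesis by (simp only: if_False mult_1_right)
      qed
      have delta: "(\<Prod>x\<in>V. \<Prod>z\<in>V. if (x, z) = (i, j) then \<rho> else 1) = \<rho>" if "i \<in> V" "j \<in> V" for i j
      proof -
        have "(\<Prod>z\<in>V. if (x, z) = (i, j) then \<rho> else 1) = (if x = i then \<rho> else 1)" for x
          using that fin by (cases "x = i") (simp_all add: prod.delta)
        then show ?thesis using that fin by (simp add: prod.delta)
      qed
      have "(\<Prod>x\<in>V. \<Prod>z\<in>V. B c x z) = (\<Prod>x\<in>V. \<Prod>z\<in>V. B a x z
          * (if (x, z) = (u, v) then \<rho> else 1) * (if (x, z) = (v, u) then \<rho> else 1))"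
        by (intro prod.cong refl Bc)
      also have "\<dots> = (\<Prod>x\<in>V. \<Prod>z\<in>V. B a x z) * \<rho> * \<rho>"
        unfolding prod.distrib delta[OF u v] delta[OF v u] by (rule refl)
      also have "\<dots> \<le> (\<Prod>x\<in>V. Z a x)\<^sup>2 * \<rho> * \<rho>"
        using aPhi \<rho>0 by (intro mult_right_mono) auto
      also have "\<dots> = ((\<Prod>x\<in>V. Z a x) * \<rho>)\<^sup>2" by (simp add: power2_eq_square)
      also have "\<dots> \<le> (\<Prod>x\<in>V. Z c x)\<^sup>2"
      proof (rule power_mono)
        have Za: "0 \<le> Z a x" if "x \<in> V" for x
          using that bp0[OF that] bm[OF that] Mp1a Mm0a unfolding Z_def
          by (auto intro!: add_nonneg_nonneg mult_nonneg_nonneg prod_nonneg simp: less_imp_le)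
             (meson order.trans zero_le_one)
        have "Z a v * \<rho> \<le> Z c v"
        proof -
          have "(1 + k * a (u, v) * r) * \<rho> \<le> 1 + k * y * r"
            using ratio_mono[OF k0 au less_imp_le[OF y_gt] av r_ge] dpos
            unfolding \<rho>_def by (simp add: pos_divide_le_eq mult_ac)
          then show ?thesis
            unfolding Zav Zcv mult.assoc[of K] using K0 by (intro mult_left_mono) auto
        qed
        then have "(Z a v * \<rho>) * (\<Prod>x\<in>V - {v}. Z a x) \<le> Z c v * (\<Prod>x\<in>V - {v}. Z a x)"
          by (rule mult_right_mono) (auto intro!: prod_nonneg Za)
        also have "(\<Prod>x\<in>V - {v}. Z a x) = (\<Prod>x\<in>V - {v}. Z c x)"
          using Zother by (intro prod.cong) auto
        finally show "(\<Prod>x\<in>V. Z a x) * \<rho> \<le> (\<Prod>x\<in>V. Z c x)"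
          using prod.remove[OF fin v, of "Z a"] prod.remove[OF fin v, of "Z c"] Zother
          by (simp add: mult_ac)
        show "0 \<le> (\<Prod>x\<in>V. Z a x) * \<rho>" using Za \<rho>0 by (auto intro!: mult_nonneg_nonneg prod_nonneg)
      qed
      finally show ?thesis .
    qed
    have "c \<in> D" unfolding D_def using c0 c1 sub Phi by blast
    moreover have "c \<in> box"
      using aD y0 y1 P(1)[OF u] by (auto simp: box_def c_def PiE_iff)
    ultimately have "(\<Sum>i\<in>V\<times>V. c i) \<le> (\<Sum>i\<in>V\<times>V. a i)" by (rule amax)
    moreover have "(\<Sum>i\<in>V\<times>V. a i) < (\<Sum>i\<in>V\<times>V. c i)"
      by (rule sum_strict_mono_ex1) (use fin u v c_ge y_gt in \<open>auto simp: c_def\<close>)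
    ultimately show False by simp
  qed
  then show ?thesis using a0 a1 aPhi by blast
qed

section \<open>Normalized systems\<close>

fun opp :: "spin \<Rightarrow> spin" where
  "opp Plus = Minus" | "opp Minus = Plus"

lemma opp_neq [simp]: "opp s \<noteq> s" "s \<noteq> opp s" by (cases s; simp)+

lemma spin_cases: "t = s \<or> t = opp s" by (cases s; cases t) auto

lemma sum_spin: "(\<Sum>t\<in>UNIV. g t) = g s + g (opp s)" for g :: "spin \<Rightarrow> real"
  by (cases s) (simp_all add: UNIV_spin)

text \<open>
  A two-spin system on a vertex set \<open>V\<close> written around a Bethe fixed point: \<open>p v\<close> is a strictly
  positive law on the spins, and \<open>f u v s t\<close> is a positive symmetric factor of every pair of
  vertices whose average over the law of either end is 1 and which favours equal spins
  (nonnegative determinant).  The factor is constantly 1 for pairs that are not joined, and also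
  on the diagonal, so that products may run over all of \<open>V \<times> V\<close>.
\<close>

definition normalized_system ::
    "'a set \<Rightarrow> ('a \<Rightarrow> spin \<Rightarrow> real) \<Rightarrow> ('a \<Rightarrow> 'a \<Rightarrow> spin \<Rightarrow> spin \<Rightarrow> real) \<Rightarrow> bool" where
  "normalized_system V p f \<longleftrightarrow>
     (\<forall>v\<in>V. (\<forall>s. 0 < p v s) \<and> (\<Sum>s\<in>UNIV. p v s) = 1 \<and> (\<forall>s t. f v v s t = 1)) \<and>
     (\<forall>u\<in>V. \<forall>v\<in>V. (\<forall>s t. 0 < f u v s t) \<and> (\<forall>s t. f u v s t = f v u t s)
        \<and> (\<forall>t. (\<Sum>s\<in>UNIV. p u s * f u v s t) = 1)
        \<and> f u v Plus Minus * f u v Minus Plus \<le> f u v Plus Plus * f u v Minus Minus)"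

lemma normalized_systemD:
  assumes "normalized_system V p f" "u \<in> V" "v \<in> V"
  shows "0 < p v s" "(\<Sum>s\<in>UNIV. p v s) = 1" "f v v s r = 1" "0 < f u v s r"
    "f u v s r = f v u r s" "(\<Sum>s\<in>UNIV. p u s * f u v s r) = 1"
    "f u v Plus Minus * f u v Minus Plus \<le> f u v Plus Plus * f u v Minus Minus"
  using assms unfolding normalized_system_def by blast+

text \<open>
  The partition function.  The product over ordered pairs counts every edge twice, whence
  the square root.
\<close>

definition system_Z ::
    "'a set \<Rightarrow> ('a \<Rightarrow> spin \<Rightarrow> real) \<Rightarrow> ('a \<Rightarrow> 'a \<Rightarrow> spin \<Rightarrow> spin \<Rightarrow> real) \<Rightarrow> real" where
  "system_Z V b f =
     (\<Sum>\<sigma>\<in>V \<rightarrow>\<^sub>E UNIV. (\<Prod>v\<in>V. b v (\<sigma> v)) * sqrt (\<Prod>u\<in>V. \<Prod>v\<in>V. f u v (\<sigma> u) (\<sigma> v)))"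

text \<open>
  A factor with both averages equal to 1 has only one degree of freedom: it is
  \<open>1 + \<kappa> * x * y\<close> with \<open>x\<close>, \<open>y\<close> the centred indicators of the distinguished spin at the
  two ends, and \<open>\<kappa>\<close> is its determinant.
\<close>

lemma normalized_factor_form:
  fixes P Q :: real
  assumes P: "0 < P" "P < 1" and Q: "0 < Q" "Q < 1"
    and 1: "P * f11 + (1 - P) * f01 = 1" and 2: "P * f10 + (1 - P) * f00 = 1"
    and 3: "Q * f11 + (1 - Q) * f10 = 1" 
  defines "\<kappa> \<equiv> f11 * f00 - f10 * f01"
  shows "f11 = 1 + \<kappa> * (1 - P) * (1 - Q)" "f10 = 1 - \<kappa> * (1 - P) * Q"
    "f01 = 1 - \<kappa> * P * (1 - Q)" "f00 = 1 + \<kappa> * P * Q"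
proof -
  define d where "d = (f11 - 1) / ((1 - P) * (1 - Q))"
  have f11: "f11 = 1 + d * (1 - P) * (1 - Q)" using P Q by (simp add: d_def)
  have "(1 - P) * f01 = (1 - P) * (1 - d * P * (1 - Q))" using 1 by (simp add: f11 algebra_simps)
  then have f01: "f01 = 1 - d * P * (1 - Q)" using P by simp
  have "(1 - Q) * f10 = (1 - Q) * (1 - d * (1 - P) * Q)" using 3 by (simp add: f11 algebra_simps)
  then have f10: "f10 = 1 - d * (1 - P) * Q" using Q by simp
  have "(1 - P) * f00 = (1 - P) * (1 + d * P * Q)" using 2 by (simp add: f10 algebra_simps)
  then have f00: "f00 = 1 + d * P * Q" using P by simp
  have "\<kappa> = d" unfolding \<kappa>_def f11 f10 f01 f00 by (simp add: algebra_simps)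
  then show "f11 = 1 + \<kappa> * (1 - P) * (1 - Q)" "f10 = 1 - \<kappa> * (1 - P) * Q"
    "f01 = 1 - \<kappa> * P * (1 - Q)" "f00 = 1 + \<kappa> * P * Q"
    using f11 f10 f01 f00 by simp_all
qed

text \<open>
  Messages may be moved from the edge factors into the vertex weights; only the normalizing
  constants \<open>Z\<close> and \<open>B\<close> remain.
\<close>

lemma system_Z_reparametrize:
  fixes M :: "'a \<Rightarrow> 'a \<Rightarrow> spin \<Rightarrow> real"
  assumes M: "\<And>u v s. u \<in> V \<Longrightarrow> v \<in> V \<Longrightarrow> 0 < M u v s"
    and Z: "\<And>v. v \<in> V \<Longrightarrow> 0 < Z v"
    and B: "\<And>u v. u \<in> V \<Longrightarrow> v \<in> V \<Longrightarrow> 0 < B u v"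
  shows "system_Z V b f = (\<Prod>v\<in>V. Z v) / sqrt (\<Prod>u\<in>V. \<Prod>v\<in>V. B u v)
     * system_Z V (\<lambda>v s. b v s * (\<Prod>w\<in>V. M w v s) / Z v)
         (\<lambda>u v s t. f u v s t * B u v / (M u v t * M v u s))"
  (is "_ = ?c * system_Z V ?b ?f")
  unfolding system_Z_def sum_distrib_left
proof (rule sum.cong[OF refl])
  fix \<sigma> :: "'a \<Rightarrow> spin"
  define X where "X = (\<Prod>v\<in>V. \<Prod>w\<in>V. M w v (\<sigma> v))"
  have X: "0 < X" unfolding X_def using M by (intro prod_pos) auto
  have swap: "(\<Prod>u\<in>V. \<Prod>v\<in>V. M u v (\<sigma> v)) = X" unfolding X_def by (rule prod.swap)
  define BB where "BB = (\<Prod>u\<in>V. \<Prod>v\<in>V. B u v)"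
  have BB: "0 < BB" unfolding BB_def using B by (intro prod_pos) auto
  have ZZ: "0 < (\<Prod>v\<in>V. Z v)" using Z by (intro prod_pos) auto
  have b': "(\<Prod>v\<in>V. ?b v (\<sigma> v)) = (\<Prod>v\<in>V. b v (\<sigma> v)) * X / (\<Prod>v\<in>V. Z v)"
    by (simp add: prod.distrib prod_dividef X_def)
  have f': "(\<Prod>u\<in>V. \<Prod>v\<in>V. ?f u v (\<sigma> u) (\<sigma> v))
      = (\<Prod>u\<in>V. \<Prod>v\<in>V. f u v (\<sigma> u) (\<sigma> v)) * BB / X\<^sup>2"
    by (simp add: prod.distrib prod_dividef swap BB_def power2_eq_square X_def[symmetric])
  show "(\<Prod>v\<in>V. b v (\<sigma> v)) * sqrt (\<Prod>u\<in>V. \<Prod>v\<in>V. f u v (\<sigma> u) (\<sigma> v)) =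
    ?c * ((\<Prod>v\<in>V. ?b v (\<sigma> v)) * sqrt (\<Prod>u\<in>V. \<Prod>v\<in>V. ?f u v (\<sigma> u) (\<sigma> v)))"
    unfolding b' f' BB_def[symmetric] using X BB ZZ
    by (simp add: real_sqrt_divide real_sqrt_mult)
qed

text \<open>
  Tilts of mean 1 that all favour the same spin \<open>hi\<close> do not push the partition function below 1,
  provided that untilted systems on the same vertex set have partition function at least 1.
  Belief propagation with the tilts has a fixed point of Bethe value at least 1, and rewriting
  the tilted system around that fixed point gives that value times the partition function of
  another normalized system.
\<close>

lemma tilted_system_Z_ge_1:
  fixes V :: "'a set" and p t :: "'a \<Rightarrow> spin \<Rightarrow> real" and hi :: spin
  assumes fin: "finite V" and sys: "normalized_system V p f"
    and IH: "\<And>p f. normalized_system V p f \<Longrightarrow> 1 \<le> system_Z V p f"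
    and t_pos: "\<And>v s. v \<in> V \<Longrightarrow> 0 < t v s"
    and t_mono: "\<And>v. v \<in> V \<Longrightarrow> t v (opp hi) \<le> t v hi"
    and t_mean: "\<And>v. v \<in> V \<Longrightarrow> (\<Sum>s\<in>UNIV. p v s * t v s) = 1"
  shows "1 \<le> system_Z V (\<lambda>v s. p v s * t v s) f"
proof -
  let ?o = "opp hi"
  define P where "P = (\<lambda>v. p v hi)"
  define \<kappa> where "\<kappa> = (\<lambda>u v. f u v hi hi * f u v ?o ?o - f u v hi ?o * f u v ?o hi)"
  have p_pos: "0 < p v s" and p_o: "p v ?o = 1 - P v" if "v \<in> V" for v s
    using sys that by (auto simp: normalized_system_def sum_spin[of _ hi] P_def add_eq_0_iff algebra_simps)
  have P: "0 < P v" "P v < 1" if "v \<in> V" for v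
    using p_pos[OF that, of hi] p_pos[OF that, of ?o] p_o[OF that] by (auto simp: P_def)
  have f_pos: "0 < f u v s r" and f_sym: "f u v s r = f v u r s"
    and f_norm: "P u * f u v hi r + (1 - P u) * f u v ?o r = 1"
    and f_diag: "f v v s r = 1"
    if "u \<in> V" "v \<in> V" for u v s r
  proof -
    show "0 < f u v s r" "f u v s r = f v u r s" "f v v s r = 1"
      using sys that unfolding normalized_system_def by blast+
    have "(\<Sum>s\<in>UNIV. p u s * f u v s r) = 1" using sys that by (simp add: normalized_system_def)
    then show "P u * f u v hi r + (1 - P u) * f u v ?o r = 1"
      by (simp add: sum_spin[of _ hi] p_o[OF that(1)]) (simp add: P_def)
  qed
  have \<kappa>_nn: "0 \<le> \<kappa> u v" if "u \<in> V" "v \<in> V" for u v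
    using sys that unfolding normalized_system_def \<kappa>_def by (cases hi) (auto simp: mult.commute)
  have \<kappa>_sym: "\<kappa> u v = \<kappa> v u" if "u \<in> V" "v \<in> V" for u v
    using f_sym[OF that] by (simp add: \<kappa>_def)
  have form: "f u v hi hi = 1 + \<kappa> u v * (1 - P u) * (1 - P v)"
    "f u v hi ?o = 1 - \<kappa> u v * (1 - P u) * P v"
    "f u v ?o hi = 1 - \<kappa> u v * P u * (1 - P v)"
    "f u v ?o ?o = 1 + \<kappa> u v * P u * P v" if "u \<in> V" "v \<in> V" for u v
    using normalized_factor_form[OF P[OF that(1)] P[OF that(2)] f_norm[OF that, of hi] f_norm[OF that, of ?o]]
      f_norm[OF that(2,1), of hi] f_sym[OF that] by (simp_all add: \<kappa>_def)
  have \<kappa>_less: "\<kappa> u v * (1 - P u) * P v < 1" if "u \<in> V" "v \<in> V" for u v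
    using form(2)[OF that] f_pos[OF that, of hi ?o] by simp
  define bp where "bp = (\<lambda>v. p v hi * t v hi)"
  define bm where "bm = (\<lambda>v. p v ?o * t v ?o)"
  have b1: "bp v + bm v = 1" if "v \<in> V" for v
    using t_mean[OF that] by (simp add: sum_spin[of _ hi] bp_def bm_def)
  have bm0: "0 < bm v" if "v \<in> V" for v using p_pos t_pos that by (simp add: bm_def)
  have bp_ge: "P v \<le> bp v" if "v \<in> V" for v
  proof -
    have "bp v + bm v \<le> P v * t v hi + (1 - P v) * t v hi"
      using t_mono[OF that] P[OF that] p_o[OF that] by (simp add: bp_def bm_def P_def)
    then have "1 \<le> t v hi" using b1[OF that] by (simp add: algebra_simps)
    then show ?thesis using P[OF that] by (simp add: bp_def P_def)
  qed
  obtain a where a0: "\<forall>u\<in>V. \<forall>v\<in>V. 0 \<le> a (u, v) \<and> a (u, v) \<le> 1 - P u"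
    and fixp: "\<forall>u\<in>V. \<forall>v\<in>V. u \<noteq> v \<longrightarrow>
       (P u + a (u, v)) * (bm u * (\<Prod>w\<in>V - {v}. 1 - \<kappa> w u * a (w, u) * P u))
       = (1 - P u - a (u, v)) * (bp u * (\<Prod>w\<in>V - {v}. 1 + \<kappa> w u * a (w, u) * (1 - P u)))"
    and Phi: "(\<Prod>u\<in>V. \<Prod>v\<in>V. 1 + \<kappa> u v * a (u, v) * a (v, u)) \<le>
       (\<Prod>v\<in>V. bp v * (\<Prod>w\<in>V. 1 + \<kappa> w v * a (w, v) * (1 - P v))
             + bm v * (\<Prod>w\<in>V. 1 - \<kappa> w v * a (w, v) * P v))\<^sup>2"
    by (rule exE[OF bp_fixed_point_exists[where P = P and \<kappa> = \<kappa> and bp = bp and bm = bm,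
      OF fin P \<kappa>_nn \<kappa>_sym \<kappa>_less bp_ge bm0 b1]])
      (assumption+, elim conjE, rule that)
  \<comment> \<open>Messages, vertex and edge normalizers of the fixed point, and the system around it.\<close>
  define M where "M = (\<lambda>u v s. 1 + \<kappa> u v * a (u, v) * ((if s = hi then 1 else 0) - P v))"
  define b where "b = (\<lambda>v s. p v s * t v s)"
  define Z where "Z = (\<lambda>v. \<Sum>s\<in>UNIV. b v s * (\<Prod>w\<in>V. M w v s))"
  define B where "B = (\<lambda>u v. 1 + \<kappa> u v * a (u, v) * a (v, u))"
  have M_pos: "0 < M u v s" if u: "u \<in> V" and v: "v \<in> V" for u v s
  proof -
    have "\<kappa> u v * a (u, v) * P v \<le> \<kappa> u v * (1 - P u) * P v"
      using a0 that \<kappa>_nn P(1)[OF v] by (intro mult_right_mono mult_left_mono) (auto simp: less_imp_le)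
    moreover have "0 \<le> \<kappa> u v * a (u, v) * (1 - P v)"
      using a0 that \<kappa>_nn P(2)[OF v] by (intro mult_nonneg_nonneg) (auto simp: less_imp_le)
    ultimately show ?thesis using \<kappa>_less[OF that] by (auto simp: M_def)
  qed
  have b_pos: "0 < b v s" if "v \<in> V" for v s using p_pos t_pos that by (simp add: b_def)
  have Z_pos: "0 < Z v" if "v \<in> V" for v
    unfolding Z_def sum_spin[of _ hi] using b_pos M_pos that
    by (intro add_pos_pos mult_pos_pos prod_pos) auto
  have B_ge: "1 \<le> B u v" if "u \<in> V" "v \<in> V" for u v
    using a0 that \<kappa>_nn[OF that] by (simp add: B_def)
  have B_pos: "0 < B u v" if "u \<in> V" "v \<in> V" for u v
    using B_ge[OF that] by linarith
  have B_sym: "B u v = B v u" if "u \<in> V" "v \<in> V" for u v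
    using \<kappa>_sym[OF that] by (simp add: B_def mult_ac)
  define p' where "p' = (\<lambda>v s. b v s * (\<Prod>w\<in>V. M w v s) / Z v)"
  define f' where "f' = (\<lambda>u v s r. f u v s r * B u v / (M u v r * M v u s))"
  have diag: "f' v v s r = 1" if "v \<in> V" for v s r
  proof -
    have "\<kappa> v v = 0" using f_diag[OF that that] by (simp add: \<kappa>_def)
    then show ?thesis using f_diag[OF that that] by (simp add: f'_def M_def B_def)
  qed
  have p'_pos: "0 < p' v s" if "v \<in> V" for v s
    unfolding p'_def using b_pos Z_pos M_pos that
    by (intro divide_pos_pos mult_pos_pos prod_pos) auto
  have p'_sum: "(\<Sum>s\<in>UNIV. p' v s) = 1" if "v \<in> V" for v
    using Z_pos[OF that] by (simp add: p'_def sum_divide_distrib[symmetric] Z_def)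
  have norm: "(\<Sum>s\<in>UNIV. p' u s * f' u v s r) = 1" if u: "u \<in> V" and v: "v \<in> V" for u v r
  proof (cases "u = v")
    case True
    then show ?thesis using diag[OF v] p'_sum[OF v] by simp
  next
    case False
    define k where "k = (\<lambda>s. b u s * (\<Prod>w\<in>V - {v}. M w u s))"
    define K where "K = k hi + k ?o"
    have K: "0 < K" unfolding K_def k_def using b_pos M_pos u
      by (intro add_pos_pos mult_pos_pos prod_pos) auto
    have "(P u + a (u, v)) * k ?o = (1 - P u - a (u, v)) * k hi"
      using fixp u v False by (simp add: k_def b_def bp_def bm_def M_def algebra_simps)
    then have k: "k hi = K * (P u + a (u, v))" "k ?o = K * (1 - P u - a (u, v))"
      by (simp_all add: K_def algebra_simps)
    have split: "b u s * (\<Prod>w\<in>V. M w u s) = k s * M v u s" for s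
      using prod.remove[OF fin v, of "\<lambda>w. M w u s"] by (simp add: k_def)
    have Zu: "Z u = K * B u v"
      unfolding Z_def sum_spin[of _ hi] split k
      using \<kappa>_sym[OF u v] by (simp add: M_def B_def algebra_simps)
    have kf: "k hi * f u v hi r + k ?o * f u v ?o r = K * M u v r"
    proof (cases "r = hi")
      case True
      show ?thesis unfolding True form[OF u v] k M_def by (simp add: algebra_simps)
    next
      case False
      then have r: "r = ?o" using spin_cases[of r hi] by simp
      show ?thesis unfolding r form[OF u v] k M_def by (simp add: algebra_simps)
    qed
    have "p' u s * f' u v s r = k s * f u v s r / (K * M u v r)" for s
      unfolding p'_def f'_def split Zu using M_pos[OF u v, of r] M_pos[OF v u, of s] K B_pos[OF u v]
      by (simp add: field_simps)
    then have "(\<Sum>s\<in>UNIV. p' u s * f' u v s r) = (k hi * f u v hi r + k ?o * f u v ?o r) / (K * M u v r)"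
      by (simp add: sum_spin[of _ hi] add_divide_distrib)
    then show ?thesis unfolding kf using K M_pos[OF u v, of r] by simp
  qed
  have det: "f' u v Plus Minus * f' u v Minus Plus \<le> f' u v Plus Plus * f' u v Minus Minus"
    if u: "u \<in> V" and v: "v \<in> V" for u v
  proof -
    define c where "c = B u v * B u v / (M u v Plus * M u v Minus * M v u Plus * M v u Minus)"
    have "0 \<le> c" unfolding c_def using M_pos[OF u v] M_pos[OF v u] B_pos[OF u v]
      by (intro divide_nonneg_pos mult_pos_pos mult_nonneg_nonneg less_imp_le)
    moreover have "f u v Plus Minus * f u v Minus Plus \<le> f u v Plus Plus * f u v Minus Minus"
      using sys u v by (simp add: normalized_system_def)
    ultimately have "f u v Plus Minus * f u v Minus Plus * c \<le> f u v Plus Plus * f u v Minus Minus * c"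
      by (intro mult_right_mono)
    then show ?thesis by (simp add: f'_def c_def mult_ac)
  qed
  have "normalized_system V p' f'"
    unfolding normalized_system_def
  proof (intro conjI ballI allI)
    fix u v s r assume uv: "u \<in> V" "v \<in> V"
    show "0 < f' u v s r" using f_pos M_pos B_pos uv by (simp add: f'_def)
    show "f' u v s r = f' v u r s"
      using f_sym[OF uv, of s r] B_sym[OF uv] by (simp add: f'_def mult_ac)
  qed (use p'_pos p'_sum diag norm det in auto)
  then have "1 \<le> system_Z V p' f'" by (rule IH)
  moreover have "1 \<le> (\<Prod>v\<in>V. Z v) / sqrt (\<Prod>u\<in>V. \<Prod>v\<in>V. B u v)"
  proof -
    have ZZ: "0 < (\<Prod>v\<in>V. Z v)" using Z_pos by (intro prod_pos) auto
    have BB: "0 < (\<Prod>u\<in>V. \<Prod>v\<in>V. B u v)" using B_pos by (intro prod_pos) auto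
    have "Z v = bp v * (\<Prod>w\<in>V. 1 + \<kappa> w v * a (w, v) * (1 - P v))
             + bm v * (\<Prod>w\<in>V. 1 - \<kappa> w v * a (w, v) * P v)" for v
      by (simp add: Z_def sum_spin[of _ hi] b_def bp_def bm_def M_def)
    then have "(\<Prod>u\<in>V. \<Prod>v\<in>V. B u v) \<le> (\<Prod>v\<in>V. Z v)\<^sup>2" using Phi by (simp add: B_def)
    then have "sqrt (\<Prod>u\<in>V. \<Prod>v\<in>V. B u v) \<le> (\<Prod>v\<in>V. Z v)"
      using ZZ by (intro real_le_lsqrt) auto
    then show ?thesis using BB by simp
  qed
  ultimately have "1 * 1 \<le> (\<Prod>v\<in>V. Z v) / sqrt (\<Prod>u\<in>V. \<Prod>v\<in>V. B u v) * system_Z V p' f'"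
    by (intro mult_mono) auto
  also have "\<dots> = system_Z V b f"
    unfolding p'_def f'_def by (rule system_Z_reparametrize[symmetric]) (use M_pos Z_pos B_pos in auto)
  finally show ?thesis by (simp add: b_def)
qed

text \<open>Clamping the vertex \<open>i\<close> to \<open>s\<close> tilts every other vertex \<open>v\<close> by \<open>f i v s\<close>.\<close>

lemma system_Z_insert:
  fixes V :: "'a set"
  assumes fin: "finite V" and i: "i \<notin> V" and sys: "normalized_system (insert i V) p f"
  shows "system_Z (insert i V) p f
    = (\<Sum>s\<in>UNIV. p i s * system_Z V (\<lambda>v r. p v r * f i v s r) f)"
proof -
  have f_pos: "0 < f u v s r" and f_sym: "f u v s r = f v u r s" and f_diag: "f v v s r = 1"
    if "u \<in> insert i V" "v \<in> insert i V" for u v s r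
    using sys that unfolding normalized_system_def by blast+
  have inj: "inj_on (\<lambda>(s, \<sigma>). \<sigma>(i := s)) (UNIV \<times> (V \<rightarrow>\<^sub>E (UNIV :: spin set)))"
  proof (rule inj_onI, unfold split_paired_all prod.case mem_Times_iff fst_conv snd_conv prod.inject)
    fix s s' :: spin and \<sigma> \<sigma>' assume e: "\<sigma>(i := s) = \<sigma>'(i := s')"
      and "s \<in> UNIV \<and> \<sigma> \<in> V \<rightarrow>\<^sub>E UNIV" "s' \<in> UNIV \<and> \<sigma>' \<in> V \<rightarrow>\<^sub>E UNIV"
    then have E: "\<sigma> \<in> extensional V" "\<sigma>' \<in> extensional V" by (auto simp: PiE_def)
    have "\<sigma> x = \<sigma>' x" for x
      using fun_cong[OF e, of x] E i by (cases "x = i") (auto simp: extensional_def)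
    then show "s = s' \<and> \<sigma> = \<sigma>'" using fun_cong[OF e, of i] by auto
  qed
  have "system_Z (insert i V) p f = (\<Sum>(s, \<sigma>)\<in>UNIV \<times> (V \<rightarrow>\<^sub>E UNIV).
      (\<Prod>v\<in>insert i V. p v ((\<sigma>(i := s)) v)) *
      sqrt (\<Prod>u\<in>insert i V. \<Prod>v\<in>insert i V. f u v ((\<sigma>(i := s)) u) ((\<sigma>(i := s)) v)))"
    unfolding system_Z_def PiE_insert_eq by (subst sum.reindex[OF inj]) (simp add: case_prod_unfold)
  also have "\<dots> = (\<Sum>(s, \<sigma>)\<in>UNIV \<times> (V \<rightarrow>\<^sub>E UNIV). p i s *
      ((\<Prod>v\<in>V. p v (\<sigma> v) * f i v s (\<sigma> v)) * sqrt (\<Prod>u\<in>V. \<Prod>v\<in>V. f u v (\<sigma> u) (\<sigma> v))))"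
  proof (intro sum.cong refl, clarify)
    fix s :: spin and \<sigma> :: "'a \<Rightarrow> spin"
    define X where "X = (\<Prod>v\<in>V. f i v s (\<sigma> v))"
    define \<tau> where "\<tau> = \<sigma>(i := s)"
    have \<tau>: "\<tau> i = s" "\<And>v. v \<in> V \<Longrightarrow> \<tau> v = \<sigma> v" using i by (auto simp: \<tau>_def)
    have X: "0 < X" unfolding X_def using f_pos by (intro prod_pos) auto
    have X': "(\<Prod>u\<in>V. f u i (\<sigma> u) s) = X" unfolding X_def
      using f_sym by (intro prod.cong) auto
    have "(\<Prod>u\<in>insert i V. \<Prod>v\<in>insert i V. f u v (\<tau> u) (\<tau> v))
        = X * (\<Prod>u\<in>V. f u i (\<sigma> u) s * (\<Prod>v\<in>V. f u v (\<sigma> u) (\<sigma> v)))"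
      using fin i f_diag[of i i s s] by (simp add: \<tau> X_def cong: prod.cong)
    also have "\<dots> = (\<Prod>u\<in>V. \<Prod>v\<in>V. f u v (\<sigma> u) (\<sigma> v)) * X\<^sup>2"
      by (simp add: prod.distrib X' power2_eq_square)
    finally have w: "sqrt (\<Prod>u\<in>insert i V. \<Prod>v\<in>insert i V. f u v (\<tau> u) (\<tau> v))
        = sqrt (\<Prod>u\<in>V. \<Prod>v\<in>V. f u v (\<sigma> u) (\<sigma> v)) * X"
      using X by (simp add: real_sqrt_mult)
    have b: "(\<Prod>v\<in>insert i V. p v (\<tau> v)) = p i s * (\<Prod>v\<in>V. p v (\<sigma> v))"
      using fin i by (simp add: \<tau> cong: prod.cong)
    show "(\<Prod>v\<in>insert i V. p v ((\<sigma>(i := s)) v)) *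
      sqrt (\<Prod>u\<in>insert i V. \<Prod>v\<in>insert i V. f u v ((\<sigma>(i := s)) u) ((\<sigma>(i := s)) v))
      = p i s * ((\<Prod>v\<in>V. p v (\<sigma> v) * f i v s (\<sigma> v)) * sqrt (\<Prod>u\<in>V. \<Prod>v\<in>V. f u v (\<sigma> u) (\<sigma> v)))"
      unfolding \<tau>_def[symmetric] w b by (simp add: prod.distrib X_def)
  qed
  also have "\<dots> = (\<Sum>s\<in>UNIV. p i s * system_Z V (\<lambda>v r. p v r * f i v s r) f)"
    by (simp add: sum.cartesian_product[symmetric] sum_distrib_left system_Z_def)
  finally show ?thesis .
qed

text \<open>
  Bethe's value 1 is a lower bound for the partition function of every normalized system, by
  clamping one vertex after the other.  The tilts caused by clamping to \<open>s\<close> have mean 1 and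
  favour \<open>s\<close> everywhere, so each of the two clamped systems contributes at least \<open>p i s\<close>.
\<close>

theorem normalized_system_Z_ge_1:
  assumes "finite V" "normalized_system V p f"
  shows "1 \<le> system_Z V p f"
  using assms
proof (induction V arbitrary: p f)
  case empty
  then show ?case by (simp add: system_Z_def)
next
  case (insert i V)
  note sys = insert.prems
  have sysV: "normalized_system V p f"
    using sys unfolding normalized_system_def by blast
  have "1 \<le> system_Z V (\<lambda>v r. p v r * f i v s r) f" for s
  proof (rule tilted_system_Z_ge_1[OF insert.hyps(1) sysV insert.IH, where hi = s])
    fix v assume v: "v \<in> V"
    have iV: "i \<in> insert i V" "v \<in> insert i V" using v by auto
    note iD = normalized_systemD[OF sys iV] and vD = normalized_systemD[OF sys iV(2,1)]
    show "0 < f i v s r" for r by (rule iD(4))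
    have norm: "(\<Sum>r\<in>UNIV. p v r * f i v s r) = 1" for s
      unfolding iD(5) by (rule vD(6))
    then show "(\<Sum>r\<in>UNIV. p v r * f i v s r) = 1" .
    have norm': "p i Plus * f i v Plus r + p i Minus * f i v Minus r = 1" for r
      using iD(6)[of r] by (simp add: UNIV_spin)
    have p: "0 < p v Plus" "0 < p v Minus" "p v Plus + p v Minus = 1"
      "0 < p i Plus" "0 < p i Minus" "p i Plus + p i Minus = 1"
      using iD(1,2) vD(1,2) by (simp_all add: UNIV_spin)
    note det = iD(7)
    define P Q \<kappa> where "P = p i Plus" and "Q = p v Plus"
      and "\<kappa> = f i v Plus Plus * f i v Minus Minus - f i v Plus Minus * f i v Minus Plus"
    have PQ: "p i Minus = 1 - P" "p v Minus = 1 - Q" "0 < P" "P < 1" "0 < Q" "Q < 1"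
      using p by (auto simp: P_def Q_def)
    have \<kappa>: "0 \<le> \<kappa>" using det by (simp add: \<kappa>_def)
    have form: "f i v Plus Plus = 1 + \<kappa> * (1 - P) * (1 - Q)" "f i v Plus Minus = 1 - \<kappa> * (1 - P) * Q"
      "f i v Minus Plus = 1 - \<kappa> * P * (1 - Q)" "f i v Minus Minus = 1 + \<kappa> * P * Q"
      unfolding \<kappa>_def
      using normalized_factor_form[OF PQ(3-6), of "f i v Plus Plus" "f i v Minus Plus" "f i v Plus Minus" "f i v Minus Minus"]
        norm'[of Plus] norm'[of Minus] norm[of Plus] PQ(1,2)
      by (simp_all add: P_def Q_def UNIV_spin)
    have "0 \<le> \<kappa> * (1 - P) * (1 - Q)" "0 \<le> \<kappa> * (1 - P) * Q" "0 \<le> \<kappa> * P * (1 - Q)" "0 \<le> \<kappa> * P * Q"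
      using \<kappa> PQ by simp_all
    then show "f i v s (opp s) \<le> f i v s s" by (cases s) (simp_all add: form)
  qed
  moreover have "0 < p i s" for s using normalized_systemD(1)[OF sys] by blast
  ultimately have "(\<Sum>s\<in>UNIV. p i s * 1)
      \<le> (\<Sum>s\<in>UNIV. p i s * system_Z V (\<lambda>v r. p v r * f i v s r) f)"
    by (intro sum_mono mult_left_mono) (auto simp: less_imp_le)
  moreover have "(\<Sum>s\<in>UNIV. p i s) = 1" using normalized_systemD(2)[OF sys] by blast
  ultimately show ?case using system_Z_insert[OF insert.hyps sys] by simp
qed

section \<open>Maximizers of the Bethe functional\<close>

definition bethe_maximizer ::
    "'a set \<Rightarrow> 'a set set \<Rightarrow> (spin \<Rightarrow> spin \<Rightarrow> real) \<Rightarrow> (spin \<Rightarrow> real) \<Rightarrow>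
     ('a \<Rightarrow> spin \<Rightarrow> real) \<Rightarrow> ('a set \<Rightarrow> spin \<Rightarrow> spin \<Rightarrow> real) \<Rightarrow> bool" where
  "bethe_maximizer V E \<psi> \<psi>' m n \<longleftrightarrow> (m, n) \<in> local_marginals V E \<and>
     (\<forall>(m', n')\<in>local_marginals V E. log_bethe V E \<psi> \<psi>' m' n' \<le> log_bethe V E \<psi> \<psi>' m n)"

lemma local_marginalsD:
  assumes "(m, n) \<in> local_marginals V E"
  shows "v \<in> V \<Longrightarrow> 0 \<le> m v s" "e \<in> E \<Longrightarrow> 0 \<le> n e s t"
    "v \<in> V \<Longrightarrow> m v s + m v (opp s) = 1"
    "e \<in> E \<Longrightarrow> n e s t + n e (opp s) t = m (tgt e) t"
    "e \<in> E \<Longrightarrow> n e s t + n e s (opp t) = m (src e) s"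
  using assms sum_spin[of "m v" s] sum_spin[of "\<lambda>s. n e s t" s] sum_spin[of "n e s" t]
  by (auto simp: local_marginals_def)

lemma local_marginals_le_1:
  assumes "(m, n) \<in> local_marginals V E" "v \<in> V"
  shows "m v s \<le> 1"
  using local_marginalsD(1)[OF assms, of "opp s"] local_marginalsD(3)[OF assms, of s] by linarith

text \<open>
  The contribution of one vertex to \<open>log_bethe\<close> (energy and entropy), and that of one edge
  (energy minus mutual information), as functions of the marginals.
\<close>

definition vertex_term :: "(spin \<Rightarrow> real) \<Rightarrow> (spin \<Rightarrow> real) \<Rightarrow> real" where
  "vertex_term \<psi>' a = (\<Sum>s\<in>UNIV. a s * ln (\<psi>' s)) - (\<Sum>s\<in>UNIV. a s * ln (a s))"

definition edge_term ::
    "(spin \<Rightarrow> spin \<Rightarrow> real) \<Rightarrow> (spin \<Rightarrow> real) \<Rightarrow> (spin \<Rightarrow> real) \<Rightarrow> (spin \<Rightarrow> spin \<Rightarrow> real) \<Rightarrow> real" where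
  "edge_term \<psi> a b c = (\<Sum>s\<in>UNIV. \<Sum>t\<in>UNIV. c s t * ln (\<psi> s t))
     - (\<Sum>s\<in>UNIV. \<Sum>t\<in>UNIV. c s t * ln (c s t / (a s * b t)))"

lemma log_bethe_split:
  "log_bethe V E \<psi> \<psi>' m n =
     (\<Sum>v\<in>V. vertex_term \<psi>' (m v)) + (\<Sum>e\<in>E. edge_term \<psi> (m (src e)) (m (tgt e)) (n e))"
  by (simp add: log_bethe_def vertex_term_def edge_term_def sum_subtractf)

text \<open>The mutual information of independent ends vanishes, including zero entries.\<close>

lemma edge_term_product:
  "edge_term \<psi> a b (\<lambda>s t. a s * b t) = (\<Sum>s\<in>UNIV. \<Sum>t\<in>UNIV. a s * b t * ln (\<psi> s t))"
proof -
  have "x * ln (x / x) = 0" for x :: real by (cases "x = 0") auto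
  then show ?thesis unfolding edge_term_def by (simp only: sum.neutral_const diff_0_right)
qed

text \<open>If one end of an edge is deterministic, then its two ends are independent.\<close>

lemma degenerate_edge_product:
  assumes M: "(m, n) \<in> local_marginals V E" and e: "e \<in> E" "src e \<in> V" "tgt e \<in> V"
    and z: "m (src e) s = 0 \<or> m (tgt e) s = 0"
  shows "n e = (\<lambda>r t. m (src e) r * m (tgt e) t)"
proof (intro ext)
  fix r t
  note D = local_marginalsD[OF M] 
  show "n e r t = m (src e) r * m (tgt e) t"
    using z
  proof
    assume z: "m (src e) s = 0"
    then have 0: "n e s t = 0" for t
      using D(5)[OF e(1), of s t] D(2)[OF e(1), of s t] D(2)[OF e(1), of s "opp t"] by linarith
    have "n e (opp s) t = m (tgt e) t" using D(4)[OF e(1), of s t] 0 by simp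
    moreover have "m (src e) (opp s) = 1" using D(3)[OF e(2), of s] z by simp
    ultimately show ?thesis using spin_cases[of r s] 0 z by auto
  next
    assume z: "m (tgt e) s = 0"
    then have 0: "n e r s = 0" for r
      using D(4)[OF e(1), of r s] D(2)[OF e(1), of r s] D(2)[OF e(1), of "opp r" s] by linarith
    have "n e r (opp s) = m (src e) r" using D(5)[OF e(1), of r s] 0 by simp
    moreover have "m (tgt e) (opp s) = 1" using D(3)[OF e(3), of s] z by simp
    ultimately show ?thesis using spin_cases[of t s] 0 z by auto
  qed
qed

text \<open>
  If a spin had probability 0 at \<open>v\<close>, then \<open>v\<close> would be independent of its neighbours.  Giving
  that spin a small probability \<open>\<epsilon>\<close> and keeping the independence gains \<open>- \<epsilon> * ln \<epsilon>\<close> of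
  entropy at the cost of \<open>O(\<epsilon>)\<close> energy.
\<close>

lemma maximizer_vertex_pos:
  fixes V :: "'a set"
  assumes G: "finite_simple_graph V E" and max: "bethe_maximizer V E \<psi> \<psi>' m n" and v: "v \<in> V"
  shows "0 < m v s"
proof (rule ccontr)
  assume "\<not> 0 < m v s"
  have M: "(m, n) \<in> local_marginals V E"
    and ub: "\<And>m' n'. (m', n') \<in> local_marginals V E \<Longrightarrow> log_bethe V E \<psi> \<psi>' m' n' \<le> log_bethe V E \<psi> \<psi>' m n"
    using max by (auto simp: bethe_maximizer_def)
  note D = local_marginalsD[OF M] and E = ends_in_graph[OF G]
  have finV: "finite V" using G by (simp add: finite_simple_graph_def)
  have ms: "m v s = 0" using \<open>\<not> 0 < m v s\<close> D(1)[OF v, of s] by simp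
  have mo: "m v (opp s) = 1" using D(3)[OF v, of s] ms by simp
  define C where "C = \<bar>ln (\<psi>' s)\<bar> + \<bar>ln (\<psi>' (opp s))\<bar>
    + (\<Sum>e\<in>E. \<Sum>s\<in>UNIV. \<Sum>t\<in>UNIV. \<bar>ln (\<psi> s t)\<bar>)"
  have C: "0 \<le> C" unfolding C_def by (intro add_nonneg_nonneg sum_nonneg) auto
  \<comment> \<open>\<open>C * \<epsilon>\<close> bounds the loss of energy, so \<open>- ln \<epsilon>\<close> has to exceed \<open>C\<close>.\<close>
  define \<epsilon> where "\<epsilon> = exp (- (C + 1))"
  have \<epsilon>: "0 < \<epsilon>" "\<epsilon> < 1" "ln \<epsilon> = - (C + 1)" using C by (auto simp: \<epsilon>_def)
  define m' where "m' = m(v := (\<lambda>r. if r = s then \<epsilon> else 1 - \<epsilon>))"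
  define n' where "n' = (\<lambda>e. if v = src e \<or> v = tgt e then (\<lambda>r t. m' (src e) r * m' (tgt e) t) else n e)"
  have m'_other: "m' u = m u" if "u \<noteq> v" for u using that by (simp add: m'_def)
  have m'0: "0 \<le> m' u r" if "u \<in> V" for u r using D(1)[OF that] \<epsilon> by (simp add: m'_def)
  have m'1: "(\<Sum>r\<in>UNIV. m' u r) = 1" if "u \<in> V" for u
    using D(3)[OF that, of s] by (simp add: m'_def sum_spin[of _ s])
  have "(m', n') \<in> local_marginals V E"
    unfolding local_marginals_def
  proof (clarsimp, intro conjI ballI allI)
    fix e s t assume e: "e \<in> E"
    show "0 \<le> n' e s t" using m'0 E[OF e] D(2)[OF e] by (simp add: n'_def)
    show "(\<Sum>s\<in>UNIV. n' e s t) = m' (tgt e) t"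
      using m'1[OF E(2)[OF e]] m'_other[of "tgt e"] M e
      by (auto simp: n'_def sum_distrib_right[symmetric] local_marginals_def)
    show "(\<Sum>t\<in>UNIV. n' e s t) = m' (src e) s"
      using m'1[OF E(3)[OF e]] m'_other[of "src e"] M e
      by (auto simp: n'_def sum_distrib_left[symmetric] local_marginals_def)
  qed (use m'0 m'1 in auto)
  then have "log_bethe V E \<psi> \<psi>' m' n' \<le> log_bethe V E \<psi> \<psi>' m n" by (rule ub)
  moreover have "log_bethe V E \<psi> \<psi>' m n < log_bethe V E \<psi> \<psi>' m' n'"
  proof -
    define c where "c = (\<Sum>s\<in>UNIV. \<Sum>t\<in>UNIV. \<bar>ln (\<psi> s t)\<bar>)"
    have edge: "edge_term \<psi> (m (src e)) (m (tgt e)) (n e) - \<epsilon> * c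
        \<le> edge_term \<psi> (m' (src e)) (m' (tgt e)) (n' e)" if e: "e \<in> E" for e
    proof (cases "v = src e \<or> v = tgt e")
      case False
      have "0 \<le> \<epsilon> * c" unfolding c_def using \<epsilon> by (intro mult_nonneg_nonneg sum_nonneg) auto
      moreover have "m' (src e) = m (src e)" "m' (tgt e) = m (tgt e)" using False m'_other by metis+
      ultimately show ?thesis using False by (simp add: n'_def)
    next
      case True
      have n: "n e = (\<lambda>r t. m (src e) r * m (tgt e) t)"
        using degenerate_edge_product[OF M e E(2,3)[OF e]] True ms by blast
      have n': "n' e = (\<lambda>r t. m' (src e) r * m' (tgt e) t)" using True by (simp add: n'_def)
      have diff: "\<bar>m' (src e) r * m' (tgt e) t - m (src e) r * m (tgt e) t\<bar> \<le> \<epsilon>" for r t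
      proof -
        have dv: "\<bar>m' v r - m v r\<bar> \<le> \<epsilon>" for r
          using spin_cases[of r s] ms mo \<epsilon> by (auto simp: m'_def)
        show ?thesis
        proof (cases "v = src e")
          case True
          then have "m' (tgt e) = m (tgt e)" using E(4)[OF e] m'_other by metis
          then have "\<bar>m' (src e) r * m' (tgt e) t - m (src e) r * m (tgt e) t\<bar>
              = \<bar>m' v r - m v r\<bar> * m (tgt e) t"
            using True D(1)[OF E(3)[OF e], of t] by (simp add: abs_mult left_diff_distrib[symmetric])
          also have "\<dots> \<le> \<epsilon> * 1"
            using dv[of r] local_marginals_le_1[OF M E(3)[OF e], of t] D(1)[OF E(3)[OF e], of t] \<epsilon>
            by (intro mult_mono) auto
          finally show ?thesis by simp
        next
          case False
          then have v: "v = tgt e" using \<open>v = src e \<or> v = tgt e\<close> by simp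
          have "m' (src e) = m (src e)" using False m'_other by metis
          then have "\<bar>m' (src e) r * m' (tgt e) t - m (src e) r * m (tgt e) t\<bar>
              = m (src e) r * \<bar>m' v t - m v t\<bar>"
            using v D(1)[OF E(2)[OF e], of r] by (simp add: abs_mult right_diff_distrib[symmetric])
          also have "\<dots> \<le> 1 * \<epsilon>"
            using dv[of t] local_marginals_le_1[OF M E(2)[OF e], of r] D(1)[OF E(2)[OF e], of r] \<epsilon>
            by (intro mult_mono) auto
          finally show ?thesis by simp
        qed
      qed
      have "m (src e) r * m (tgt e) t * ln (\<psi> r t) - m' (src e) r * m' (tgt e) t * ln (\<psi> r t)
          \<le> \<epsilon> * \<bar>ln (\<psi> r t)\<bar>" for r t
      proof -
        have "m (src e) r * m (tgt e) t * ln (\<psi> r t) - m' (src e) r * m' (tgt e) t * ln (\<psi> r t)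
            \<le> \<bar>m' (src e) r * m' (tgt e) t - m (src e) r * m (tgt e) t\<bar> * \<bar>ln (\<psi> r t)\<bar>"
          unfolding abs_mult[symmetric] by (simp add: algebra_simps) 
        also have "\<dots> \<le> \<epsilon> * \<bar>ln (\<psi> r t)\<bar>" using diff by (intro mult_right_mono) auto
        finally show ?thesis .
      qed
      then have "(\<Sum>r\<in>UNIV. \<Sum>t\<in>UNIV. m (src e) r * m (tgt e) t * ln (\<psi> r t)
          - m' (src e) r * m' (tgt e) t * ln (\<psi> r t)) \<le> (\<Sum>r\<in>UNIV. \<Sum>t\<in>UNIV. \<epsilon> * \<bar>ln (\<psi> r t)\<bar>)"
        by (intro sum_mono)
      then show ?thesis
        unfolding n n' edge_term_product by (simp add: sum_subtractf c_def sum_distrib_left)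
    qed
    have vertex: "vertex_term \<psi>' (m v) - \<epsilon> * (\<bar>ln (\<psi>' s)\<bar> + \<bar>ln (\<psi>' (opp s))\<bar>) + \<epsilon> * (C + 1)
        \<le> vertex_term \<psi>' (m' v)"
    proof -
      have 1: "vertex_term \<psi>' (m v) = ln (\<psi>' (opp s))"
        by (simp add: vertex_term_def sum_spin[of _ s] ms mo)
      have 2: "vertex_term \<psi>' (m' v) = \<epsilon> * ln (\<psi>' s) + (1 - \<epsilon>) * ln (\<psi>' (opp s))
          - (\<epsilon> * ln \<epsilon> + (1 - \<epsilon>) * ln (1 - \<epsilon>))"
        by (simp add: vertex_term_def sum_spin[of _ s] m'_def)
      have "(1 - \<epsilon>) * ln (1 - \<epsilon>) \<le> 0" using \<epsilon> by (intro mult_nonneg_nonpos) auto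
      moreover have "- \<epsilon> * \<bar>ln (\<psi>' s)\<bar> \<le> \<epsilon> * ln (\<psi>' s)" 
        using \<epsilon> mult_left_mono[of "- \<bar>ln (\<psi>' s)\<bar>" "ln (\<psi>' s)" \<epsilon>] by simp
      moreover have "\<epsilon> * ln (\<psi>' (opp s)) \<le> \<epsilon> * \<bar>ln (\<psi>' (opp s))\<bar>" using \<epsilon> by simp
      ultimately show ?thesis unfolding 1 2 \<epsilon>(3) by (simp add: algebra_simps)
    qed
    have "(\<Sum>e\<in>E. edge_term \<psi> (m (src e)) (m (tgt e)) (n e)) - (\<Sum>e\<in>E. \<epsilon> * c)
        \<le> (\<Sum>e\<in>E. edge_term \<psi> (m' (src e)) (m' (tgt e)) (n' e))"
      unfolding sum_subtractf[symmetric] using edge by (rule sum_mono)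
    moreover have "(\<Sum>u\<in>V - {v}. vertex_term \<psi>' (m' u)) = (\<Sum>u\<in>V - {v}. vertex_term \<psi>' (m u))"
      using m'_other by (intro sum.cong) auto
    moreover have "\<epsilon> * (C + 1) = \<epsilon> * (\<bar>ln (\<psi>' s)\<bar> + \<bar>ln (\<psi>' (opp s))\<bar>) + (\<Sum>e\<in>E. \<epsilon> * c) + \<epsilon>"
      by (simp add: C_def c_def algebra_simps)
    ultimately show ?thesis
      unfolding log_bethe_split sum.remove[OF finV v] using vertex \<epsilon>(1) by linarith
  qed
  ultimately show False by simp
qed

lemma relative_entropy_convex:
  fixes a b \<epsilon> :: real
  assumes "0 \<le> a" "0 < b" "0 < \<epsilon>" "\<epsilon> < 1"
  shows "((1 - \<epsilon>) * a + \<epsilon> * b) * ln (((1 - \<epsilon>) * a + \<epsilon> * b) / b) \<le> (1 - \<epsilon>) * (a * ln (a / b))"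
proof (cases "a = 0")
  case True
  have "\<epsilon> * b * ln \<epsilon> \<le> 0" using assms by (intro mult_nonneg_nonpos) auto
  then show ?thesis using True assms by simp
next
  case False
  define x where "x = a / b"
  define y where "y = (1 - \<epsilon>) * x + \<epsilon>"
  have x: "0 < x" and ab: "a = b * x" using assms False by (auto simp: x_def)
  have y: "0 < y" using x assms by (simp add: y_def add_pos_pos)
  have yb: "(1 - \<epsilon>) * a + \<epsilon> * b = b * y" by (simp add: ab y_def algebra_simps)
  have "ln y - ln x \<le> y / x - 1" using ln_le_minus_one[of "y / x"] x y by (simp add: ln_div)
  then have "x * (ln y - ln x) \<le> x * (y / x - 1)" using x by (intro mult_left_mono) auto
  then have "x * ln y \<le> x * ln x + (y - x)" using x by (simp add: algebra_simps)
  then have 1: "(1 - \<epsilon>) * (x * ln y) \<le> (1 - \<epsilon>) * (x * ln x + (y - x))"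
    using assms by (intro mult_left_mono) auto
  have 2: "\<epsilon> * ln y \<le> \<epsilon> * (y - 1)" using ln_le_minus_one[OF y] assms by simp
  have "y * ln y = (1 - \<epsilon>) * (x * ln y) + \<epsilon> * ln y"
    by (subst y_def) (simp add: algebra_simps)
  also have "\<dots> \<le> (1 - \<epsilon>) * (x * ln x + (y - x)) + \<epsilon> * (y - 1)" using 1 2 by linarith
  also have "\<dots> = (1 - \<epsilon>) * (x * ln x)" by (simp add: y_def algebra_simps)
  finally have "b * (y * ln y) \<le> b * ((1 - \<epsilon>) * (x * ln x))" using assms by (intro mult_left_mono) auto
  then show ?thesis unfolding yb using assms by (simp add: ab algebra_simps)
qed

text \<open>
  The edge marginal is mixed with the product of the vertex marginals, which are positive.  By
  convexity of the relative entropy this costs \<open>O(\<epsilon>)\<close>, while an entry that was 0 gains a positive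
  multiple of \<open>- \<epsilon> * ln \<epsilon>\<close>.
\<close>

lemma maximizer_edge_pos:
  fixes V :: "'a set"
  assumes G: "finite_simple_graph V E" and max: "bethe_maximizer V E \<psi> \<psi>' m n" and e: "e \<in> E"
  shows "0 < n e s t"
proof (rule ccontr)
  assume "\<not> 0 < n e s t"
  have M: "(m, n) \<in> local_marginals V E"
    and ub: "\<And>m' n'. (m', n') \<in> local_marginals V E \<Longrightarrow> log_bethe V E \<psi> \<psi>' m' n' \<le> log_bethe V E \<psi> \<psi>' m n"
    using max by (auto simp: bethe_maximizer_def)
  note D = local_marginalsD[OF M] and E = ends_in_graph[OF G e]
  have finE: "finite E" using finite_edges[OF G] .
  have ns: "n e s t = 0" using \<open>\<not> 0 < n e s t\<close> D(2)[OF e, of s t] by simp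
  define b where "b = (\<lambda>r t. m (src e) r * m (tgt e) t)"
  have b: "0 < b r u" "b r u \<le> 1" for r u
    unfolding b_def using maximizer_vertex_pos[OF G max E(2)] maximizer_vertex_pos[OF G max E(3)]
      local_marginals_le_1[OF M E(2), of r] local_marginals_le_1[OF M E(3), of u]
    by (auto intro!: mult_le_one simp: less_imp_le)
  have n1: "n e r u \<le> 1" for r u
    using D(5)[OF e, of r u] D(2)[OF e, of r "opp u"] local_marginals_le_1[OF M E(2), of r] by linarith
  define K where "K = (\<lambda>r u. \<bar>ln (\<psi> r u)\<bar> + \<bar>n e r u * ln (n e r u / b r u)\<bar>)"
  \<comment> \<open>The loss is at most \<open>\<epsilon>\<close> times the sum of all \<open>K r u\<close>, the gain is \<open>- \<epsilon> * ln \<epsilon> * b s t\<close>.\<close>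
  define \<epsilon> where "\<epsilon> = exp (- ((\<Sum>r\<in>UNIV. \<Sum>u\<in>UNIV. K r u) / b s t + 1))"
  have K0: "0 \<le> (\<Sum>r\<in>UNIV. \<Sum>u\<in>UNIV. K r u)"
    unfolding K_def by (intro sum_nonneg) auto
  have \<epsilon>: "0 < \<epsilon>" "\<epsilon> < 1" "- ln \<epsilon> * b s t = (\<Sum>r\<in>UNIV. \<Sum>u\<in>UNIV. K r u) + b s t"
    using b(1)[of s t] K0 by (auto simp: \<epsilon>_def divide_nonneg_pos add_nonneg_pos field_simps)
  define c where "c = (\<lambda>r u. (1 - \<epsilon>) * n e r u + \<epsilon> * b r u)"
  define n' where "n' = n(e := c)"
  have "(m, n') \<in> local_marginals V E"
  proof -
    have "(\<Sum>r\<in>UNIV. c r u) = m (tgt e) u" for u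
      using D(4)[OF e, of Plus u] D(3)[OF E(2), of Plus]
      unfolding c_def b_def sum.distrib sum_distrib_left[symmetric] sum_distrib_right[symmetric]
      by (simp add: sum_spin[of _ Plus] algebra_simps)
    moreover have "(\<Sum>u\<in>UNIV. c r u) = m (src e) r" for r
      using D(5)[OF e, of r Plus] D(3)[OF E(3), of Plus]
      unfolding c_def b_def sum.distrib sum_distrib_left[symmetric]
      by (simp add: sum_spin[of _ Plus] algebra_simps)
    moreover have "0 \<le> c r u" for r u
      using D(2)[OF e, of r u] b(1)[of r u] \<epsilon> by (simp add: c_def)
    ultimately show ?thesis using M by (auto simp: local_marginals_def n'_def)
  qed
  then have "log_bethe V E \<psi> \<psi>' m n' \<le> log_bethe V E \<psi> \<psi>' m n" by (rule ub)
  then have le: "edge_term \<psi> (m (src e)) (m (tgt e)) c \<le> edge_term \<psi> (m (src e)) (m (tgt e)) (n e)"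
    unfolding log_bethe_split sum.remove[OF finE e] by (simp add: n'_def)
  define g where "g = (\<lambda>x r u. x * ln (\<psi> r u) - x * ln (x / b r u))"
  have et: "edge_term \<psi> (m (src e)) (m (tgt e)) x = (\<Sum>r\<in>UNIV. \<Sum>u\<in>UNIV. g (x r u) r u)" for x
    by (simp add: edge_term_def g_def b_def sum_subtractf)
  have entry: "g (n e r u) r u - \<epsilon> * K r u \<le> g (c r u) r u
     - (if r = s \<and> u = t then - \<epsilon> * b s t * ln \<epsilon> else 0)" for r u
  proof -
    have "c r u * ln (c r u / b r u) + (if r = s \<and> u = t then - \<epsilon> * b s t * ln \<epsilon> else 0)
        \<le> (1 - \<epsilon>) * (n e r u * ln (n e r u / b r u))"
    proof (cases "r = s \<and> u = t")
      case True
      then show ?thesis using ns b(1)[of s t] by (simp add: c_def)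
    next
      case False
      then show ?thesis unfolding c_def if_not_P[OF False] add_0_right
        by (intro relative_entropy_convex D(2)[OF e] b(1) \<epsilon>)
    qed
    moreover have "- (\<epsilon> * \<bar>n e r u * ln (n e r u / b r u)\<bar>) \<le> \<epsilon> * (n e r u * ln (n e r u / b r u))"
      using \<epsilon>(1) mult_left_mono[of "- \<bar>n e r u * ln (n e r u / b r u)\<bar>" "n e r u * ln (n e r u / b r u)" \<epsilon>]
      by simp
    moreover have "n e r u * ln (\<psi> r u) - \<epsilon> * \<bar>ln (\<psi> r u)\<bar> \<le> c r u * ln (\<psi> r u)"
    proof -
      have "\<bar>b r u - n e r u\<bar> \<le> 1" using b[of r u] n1[of r u] D(2)[OF e, of r u] by linarith
      then have "\<bar>(b r u - n e r u) * ln (\<psi> r u)\<bar> \<le> 1 * \<bar>ln (\<psi> r u)\<bar>"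
        unfolding abs_mult by (intro mult_right_mono) auto
      then have "- \<bar>ln (\<psi> r u)\<bar> \<le> (b r u - n e r u) * ln (\<psi> r u)" by linarith
      then have "\<epsilon> * - \<bar>ln (\<psi> r u)\<bar> \<le> \<epsilon> * ((b r u - n e r u) * ln (\<psi> r u))"
        using \<epsilon>(1) by (intro mult_left_mono) auto
      then show ?thesis by (simp add: c_def algebra_simps)
    qed
    ultimately show ?thesis by (simp add: g_def K_def algebra_simps)
  qed
  have "(\<Sum>r\<in>UNIV. \<Sum>u\<in>UNIV. g (n e r u) r u - \<epsilon> * K r u) \<le> (\<Sum>r\<in>UNIV. \<Sum>u\<in>UNIV. g (c r u) r u
     - (if r = s \<and> u = t then - \<epsilon> * b s t * ln \<epsilon> else 0))"
    using entry by (intro sum_mono)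
  moreover have "(\<Sum>r\<in>UNIV. \<Sum>u\<in>UNIV. if r = s \<and> u = t then - \<epsilon> * b s t * ln \<epsilon> else 0)
      = \<epsilon> * (- ln \<epsilon> * b s t)"
    by (cases s; cases t) (simp_all add: UNIV_spin)
  ultimately have "edge_term \<psi> (m (src e)) (m (tgt e)) (n e) + \<epsilon> * b s t
      \<le> edge_term \<psi> (m (src e)) (m (tgt e)) c"
    unfolding et \<epsilon>(3) by (simp add: sum_subtractf sum_distrib_left[symmetric] algebra_simps)
  moreover have "0 < \<epsilon> * b s t" using \<epsilon>(1) b(1) by simp
  ultimately show False using le by linarith
qed

text \<open>
  First-order condition at the interior maximizer, for every direction that keeps the marginals
  consistent; the derivatives of the logarithms themselves cancel.
\<close>

lemma maximizer_stationary:
  fixes V :: "'a set"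
  assumes G: "finite_simple_graph V E" and max: "bethe_maximizer V E \<psi> \<psi>' m n"
    and dV: "\<And>v. v \<in> V \<Longrightarrow> (\<Sum>s\<in>UNIV. dV v s) = 0"
    and dE_tgt: "\<And>e t. e \<in> E \<Longrightarrow> (\<Sum>s\<in>UNIV. dE e s t) = dV (tgt e) t"
    and dE_src: "\<And>e s. e \<in> E \<Longrightarrow> (\<Sum>t\<in>UNIV. dE e s t) = dV (src e) s"
  shows "(\<Sum>v\<in>V. \<Sum>s\<in>UNIV. dV v s * (ln (\<psi>' s) - ln (m v s)))
    + (\<Sum>e\<in>E. \<Sum>s\<in>UNIV. \<Sum>t\<in>UNIV.
        dE e s t * (ln (\<psi> s t) - ln (n e s t / (m (src e) s * m (tgt e) t)))) = 0"
proof -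
  have M: "(m, n) \<in> local_marginals V E"
    and ub: "\<And>m' n'. (m', n') \<in> local_marginals V E \<Longrightarrow> log_bethe V E \<psi> \<psi>' m' n' \<le> log_bethe V E \<psi> \<psi>' m n"
    using max by (auto simp: bethe_maximizer_def)
  note E = ends_in_graph[OF G]
  have fin: "finite V" "finite E" using G finite_edges[OF G] by (auto simp: finite_simple_graph_def)
  have m_pos: "0 < m v s" if "v \<in> V" for v s using maximizer_vertex_pos[OF G max that] .
  have n_pos: "0 < n e s t" if "e \<in> E" for e s t using maximizer_edge_pos[OF G max that] .
  define mm where "mm = (\<lambda>x v s. m v s + x * dV v s)"
  define nn where "nn = (\<lambda>x e s t. n e s t + x * dE e s t)"
  have pos: "\<forall>\<^sub>F x in at 0. 0 \<le> a + x * d" if "0 < a" for a d :: real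
  proof -
    have "((\<lambda>x. a + x * d) \<longlongrightarrow> a + 0 * d) (at 0)" by (intro tendsto_intros)
    then have "\<forall>\<^sub>F x in at 0. 0 < a + x * d" using that by (intro order_tendstoD(1)) auto
    then show ?thesis by eventually_elim simp
  qed
  have "\<forall>\<^sub>F x in at 0. \<forall>v\<in>V. \<forall>s\<in>UNIV. 0 \<le> mm x v s"
    unfolding mm_def by (intro eventually_ball_finite ballI fin finite pos m_pos)
  moreover have "\<forall>\<^sub>F x in at 0. \<forall>e\<in>E. \<forall>s\<in>UNIV. \<forall>t\<in>UNIV. 0 \<le> nn x e s t"
    unfolding nn_def by (intro eventually_ball_finite ballI fin finite pos n_pos)
  ultimately have "\<forall>\<^sub>F x in at 0. (mm x, nn x) \<in> local_marginals V E"
  proof eventually_elim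
    case (elim x)
    then show ?case using M
      by (auto simp: local_marginals_def mm_def nn_def sum.distrib sum_distrib_left[symmetric]
          dV dE_tgt dE_src)
  qed
  then obtain r where r: "0 < r" "\<And>x. x \<noteq> 0 \<Longrightarrow> dist x 0 < r \<Longrightarrow> (mm x, nn x) \<in> local_marginals V E"
    unfolding eventually_at by blast
  have feas: "(mm x, nn x) \<in> local_marginals V E" if "\<bar>0 - x\<bar> < r" for x
    using r(2)[of x] that M by (cases "x = 0") (auto simp: mm_def nn_def)
  define F where "F = (\<lambda>x. (\<Sum>v\<in>V. \<Sum>s\<in>UNIV. mm x v s * ln (\<psi>' s))
   + (\<Sum>e\<in>E. \<Sum>s\<in>UNIV. \<Sum>t\<in>UNIV. nn x e s t * ln (\<psi> s t))
   - (\<Sum>v\<in>V. \<Sum>s\<in>UNIV. mm x v s * ln (mm x v s))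
   - (\<Sum>e\<in>E. (\<Sum>s\<in>UNIV. \<Sum>t\<in>UNIV. nn x e s t * ln (nn x e s t))
        - (\<Sum>s\<in>UNIV. mm x (src e) s * ln (mm x (src e) s))
        - (\<Sum>t\<in>UNIV. mm x (tgt e) t * ln (mm x (tgt e) t))))"
  have F: "F x = log_bethe V E \<psi> \<psi>' (mm x) (nn x)" if "\<bar>0 - x\<bar> < r" for x
    unfolding F_def using log_bethe_expand[OF G feas[OF that]] by simp
  have lin: "((\<lambda>x. (a + x * d) * c) has_real_derivative d * c) (at 0)" for a d c :: real
    by (auto intro!: derivative_eq_intros)
  have ent: "((\<lambda>x. (a + x * d) * ln (a + x * d)) has_real_derivative d * (ln a + 1)) (at 0)"
    if "0 < a" for a d :: real
    using that by (auto intro!: derivative_eq_intros simp: field_simps)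
  define D where "D = (\<Sum>v\<in>V. \<Sum>s\<in>UNIV. dV v s * ln (\<psi>' s))
   + (\<Sum>e\<in>E. \<Sum>s\<in>UNIV. \<Sum>t\<in>UNIV. dE e s t * ln (\<psi> s t))
   - (\<Sum>v\<in>V. \<Sum>s\<in>UNIV. dV v s * (ln (m v s) + 1))
   - (\<Sum>e\<in>E. (\<Sum>s\<in>UNIV. \<Sum>t\<in>UNIV. dE e s t * (ln (n e s t) + 1))
        - (\<Sum>s\<in>UNIV. dV (src e) s * (ln (m (src e) s) + 1))
        - (\<Sum>t\<in>UNIV. dV (tgt e) t * (ln (m (tgt e) t) + 1)))"
  have "(F has_real_derivative D) (at 0)"
    unfolding F_def D_def mm_def nn_def
    by (intro DERIV_add DERIV_diff DERIV_sum lin ent m_pos n_pos E) assumption+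
  then have "D = 0"
  proof (rule DERIV_local_max[OF _ r(1)], intro allI impI)
    fix x assume x: "\<bar>0 - x\<bar> < r"
    have "F 0 = log_bethe V E \<psi> \<psi>' m n" using F[of 0] r(1) by (simp add: mm_def nn_def)
    then show "F x \<le> F 0" using F[OF x] ub[OF feas[OF x]] by simp
  qed
  have edge: "(\<Sum>s\<in>UNIV. \<Sum>t\<in>UNIV. dE e s t * (ln (n e s t) + 1))
        - (\<Sum>s\<in>UNIV. dV (src e) s * (ln (m (src e) s) + 1))
        - (\<Sum>t\<in>UNIV. dV (tgt e) t * (ln (m (tgt e) t) + 1))
      = (\<Sum>s\<in>UNIV. \<Sum>t\<in>UNIV. dE e s t * ln (n e s t / (m (src e) s * m (tgt e) t)))"
    if e: "e \<in> E" for e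
  proof -
    have total: "dE e Plus Plus + dE e Plus Minus + dE e Minus Plus + dE e Minus Minus = 0"
      using dV[OF E(2)[OF e]] unfolding dE_src[OF e, symmetric] by (simp add: UNIV_spin)
    have ln_eq: "ln (n e s t / (m (src e) s * m (tgt e) t))
        = ln (n e s t) - ln (m (src e) s) - ln (m (tgt e) t)" for s t
      using n_pos[OF e, of s t] m_pos[OF E(2)[OF e], of s] m_pos[OF E(3)[OF e], of t]
      by (simp add: ln_div ln_mult)
    show ?thesis
      unfolding dE_tgt[OF e, symmetric] dE_src[OF e, symmetric] ln_eq using total
      by (simp add: UNIV_spin algebra_simps)
  qed
  have vert: "(\<Sum>s\<in>UNIV. dV v s * (ln (m v s) + 1)) = (\<Sum>s\<in>UNIV. dV v s * ln (m v s))"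
    if "v \<in> V" for v
    using dV[OF that] by (simp add: sum.distrib distrib_left)
  show ?thesis
    using \<open>D = 0\<close> unfolding D_def
    by (simp add: edge vert sum_subtractf right_diff_distrib cong: sum.cong)
qed

text \<open>The density of an edge marginal with respect to the product of its vertex marginals.\<close>

definition edge_factor ::
    "('a \<Rightarrow> spin \<Rightarrow> real) \<Rightarrow> ('a set \<Rightarrow> spin \<Rightarrow> spin \<Rightarrow> real) \<Rightarrow> 'a set \<Rightarrow> spin \<Rightarrow> spin \<Rightarrow> real" where
  "edge_factor m n e s t = n e s t / (m (src e) s * m (tgt e) t)"

text \<open>
  Stationarity in the direction from the maximizer to the point mass at \<open>\<sigma>\<close> says that the weight
  of every single configuration equals the Bethe value times the product of the marginal
  densities.
\<close>

lemma maximizer_reparametrization: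
  fixes V :: "'a set"
  assumes G: "finite_simple_graph V E" and max: "bethe_maximizer V E \<psi> \<psi>' m n"
    and \<psi>: "\<And>s t. 0 < \<psi> s t" and \<psi>': "\<And>s. 0 < \<psi>' s"
  shows "(\<Prod>v\<in>V. \<psi>' (\<sigma> v)) * (\<Prod>e\<in>E. \<psi> (\<sigma> (src e)) (\<sigma> (tgt e)))
    = exp (log_bethe V E \<psi> \<psi>' m n) *
      ((\<Prod>v\<in>V. m v (\<sigma> v)) * (\<Prod>e\<in>E. edge_factor m n e (\<sigma> (src e)) (\<sigma> (tgt e))))"
proof -
  have M: "(m, n) \<in> local_marginals V E" using max by (auto simp: bethe_maximizer_def)
  note E = ends_in_graph[OF G]
  have fin: "finite V" "finite E" using G finite_edges[OF G] by (auto simp: finite_simple_graph_def)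
  have m_pos: "0 < m v s" if "v \<in> V" for v s using maximizer_vertex_pos[OF G max that] .
  have f_pos: "0 < edge_factor m n e s t" if "e \<in> E" for e s t
    using maximizer_edge_pos[OF G max that] m_pos E(2,3)[OF that] by (simp add: edge_factor_def)
  \<comment> \<open>The direction from \<open>(m, n)\<close> to the point mass at \<open>\<sigma>\<close>.\<close>
  define dV where "dV = (\<lambda>v s. of_bool (\<sigma> v = s) - m v s)"
  define dE where "dE = (\<lambda>e s t. of_bool (\<sigma> (src e) = s \<and> \<sigma> (tgt e) = t) - n e s t)"
  have pick: "(\<Sum>s\<in>UNIV. of_bool (a = s) * g s) = g a" for a :: spin and g :: "spin \<Rightarrow> real"
    by (cases a) (simp_all add: UNIV_spin)
  have pick2: "(\<Sum>s\<in>UNIV. \<Sum>t\<in>UNIV. of_bool (a = s \<and> b = t) * g s t) = g a b"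
    for a b :: spin and g :: "spin \<Rightarrow> spin \<Rightarrow> real"
    by (cases a; cases b) (simp_all add: UNIV_spin)
  have stat: "(\<Sum>v\<in>V. \<Sum>s\<in>UNIV. dV v s * (ln (\<psi>' s) - ln (m v s)))
    + (\<Sum>e\<in>E. \<Sum>s\<in>UNIV. \<Sum>t\<in>UNIV. dE e s t * (ln (\<psi> s t) - ln (edge_factor m n e s t))) = 0"
    unfolding edge_factor_def
  proof (rule maximizer_stationary[OF G max])
    fix v assume "v \<in> V"
    then show "(\<Sum>s\<in>UNIV. dV v s) = 0"
      using local_marginalsD(3)[OF M, of v Plus] by (cases "\<sigma> v") (simp_all add: dV_def UNIV_spin)
  next
    fix e t assume e: "e \<in> E"
    show "(\<Sum>s\<in>UNIV. dE e s t) = dV (tgt e) t"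
      using local_marginalsD(4)[OF M e, of Plus t]
      by (cases "\<sigma> (src e)") (auto simp: dE_def dV_def UNIV_spin)
    show "(\<Sum>s\<in>UNIV. dE e t s) = dV (src e) t"
      using local_marginalsD(5)[OF M e, of t Plus]
      by (cases "\<sigma> (tgt e)") (auto simp: dE_def dV_def UNIV_spin)
  qed
  have "(\<Sum>v\<in>V. ln (\<psi>' (\<sigma> v)) - ln (m v (\<sigma> v)))
    + (\<Sum>e\<in>E. ln (\<psi> (\<sigma> (src e)) (\<sigma> (tgt e))) - ln (edge_factor m n e (\<sigma> (src e)) (\<sigma> (tgt e))))
    = log_bethe V E \<psi> \<psi>' m n"
    using stat unfolding dV_def dE_def left_diff_distrib sum_subtractf pick pick2
    by (simp add: log_bethe_def edge_factor_def right_diff_distrib sum_subtractf)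
  then have L: "log_bethe V E \<psi> \<psi>' m n
      + ((\<Sum>v\<in>V. ln (m v (\<sigma> v))) + (\<Sum>e\<in>E. ln (edge_factor m n e (\<sigma> (src e)) (\<sigma> (tgt e)))))
    = (\<Sum>v\<in>V. ln (\<psi>' (\<sigma> v))) + (\<Sum>e\<in>E. ln (\<psi> (\<sigma> (src e)) (\<sigma> (tgt e))))"
    by (simp add: sum_subtractf)
  have "exp (\<Sum>v\<in>V. ln (m v (\<sigma> v))) = (\<Prod>v\<in>V. m v (\<sigma> v))"
    "exp (\<Sum>v\<in>V. ln (\<psi>' (\<sigma> v))) = (\<Prod>v\<in>V. \<psi>' (\<sigma> v))"
    "exp (\<Sum>e\<in>E. ln (edge_factor m n e (\<sigma> (src e)) (\<sigma> (tgt e))))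
      = (\<Prod>e\<in>E. edge_factor m n e (\<sigma> (src e)) (\<sigma> (tgt e)))"
    "exp (\<Sum>e\<in>E. ln (\<psi> (\<sigma> (src e)) (\<sigma> (tgt e)))) = (\<Prod>e\<in>E. \<psi> (\<sigma> (src e)) (\<sigma> (tgt e)))"
    using m_pos f_pos \<psi> \<psi>' fin by (simp_all add: exp_sum)
  then show ?thesis using arg_cong[OF L, of exp] by (simp add: exp_add)
qed

text \<open>
  Raising the diagonal entries of one edge marginal and lowering the other two by the same amount
  leaves all vertex marginals alone;
  stationarity in this direction says that \<open>\<psi>\<close> and the edge factor have the same cross ratio.
\<close>

lemma maximizer_edge_determinant:
  fixes V :: "'a set"
  assumes G: "finite_simple_graph V E" and max: "bethe_maximizer V E \<psi> \<psi>' m n"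
    and \<psi>: "\<And>s t. 0 < \<psi> s t"
    and ferro: "\<psi> Plus Minus * \<psi> Minus Plus \<le> \<psi> Plus Plus * \<psi> Minus Minus"
    and e: "e \<in> E"
  shows "edge_factor m n e Plus Minus * edge_factor m n e Minus Plus
      \<le> edge_factor m n e Plus Plus * edge_factor m n e Minus Minus"
proof -
  note E = ends_in_graph[OF G e]
  have finE: "finite E" using finite_edges[OF G] .
  have f_pos: "0 < edge_factor m n e s t" for s t
    using maximizer_edge_pos[OF G max e] maximizer_vertex_pos[OF G max] E(2,3)
    by (simp add: edge_factor_def)
  define dE where "dE = (\<lambda>e' (s::spin) t. if e' = e then (if s = t then 1 else -1) else 0 :: real)"
  have "(\<Sum>v\<in>V. \<Sum>s\<in>UNIV. 0 * (ln (\<psi>' s) - ln (m v s)))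
    + (\<Sum>e\<in>E. \<Sum>s\<in>UNIV. \<Sum>t\<in>UNIV.
        dE e s t * (ln (\<psi> s t) - ln (n e s t / (m (src e) s * m (tgt e) t)))) = 0"
  proof (rule maximizer_stationary[OF G max])
    show "(\<Sum>s\<in>UNIV. dE e' s t) = 0" "(\<Sum>s\<in>UNIV. dE e' t s) = 0" for e' t
      by (cases t; simp add: dE_def UNIV_spin)+
  qed simp
  then have "(\<Sum>s\<in>UNIV. \<Sum>t\<in>UNIV. dE e s t * (ln (\<psi> s t) - ln (edge_factor m n e s t))) = 0"
    using sum.remove[OF finE e, of "\<lambda>e. \<Sum>s\<in>UNIV. \<Sum>t\<in>UNIV.
        dE e s t * (ln (\<psi> s t) - ln (edge_factor m n e s t))"]
    by (simp add: edge_factor_def dE_def)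
  then have "ln (edge_factor m n e Plus Plus * edge_factor m n e Minus Minus)
      - ln (edge_factor m n e Plus Minus * edge_factor m n e Minus Plus)
    = ln (\<psi> Plus Plus * \<psi> Minus Minus) - ln (\<psi> Plus Minus * \<psi> Minus Plus)"
    using f_pos \<psi> by (simp add: dE_def UNIV_spin ln_mult_pos)
  moreover have "ln (\<psi> Plus Minus * \<psi> Minus Plus) \<le> ln (\<psi> Plus Plus * \<psi> Minus Minus)"
    using ferro \<psi> by (intro ln_mono) auto
  ultimately have "ln (edge_factor m n e Plus Minus * edge_factor m n e Minus Plus)
      \<le> ln (edge_factor m n e Plus Plus * edge_factor m n e Minus Minus)" by linarith
  then show ?thesis using f_pos by (subst (asm) ln_le_cancel_iff) auto
qed

lemma prod_ordered_pairs:
  fixes h :: "'a \<Rightarrow> 'a \<Rightarrow> real"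
  assumes G: "finite_simple_graph V E"
    and sym: "\<And>u v. h u v = h v u" and off: "\<And>u v. {u, v} \<notin> E \<Longrightarrow> h u v = 1"
  shows "(\<Prod>u\<in>V. \<Prod>v\<in>V. h u v) = (\<Prod>e\<in>E. h (src e) (tgt e))\<^sup>2"
proof -
  note E = ends_in_graph[OF G]
  have fin: "finite V" "finite E" using G finite_edges[OF G] by (auto simp: finite_simple_graph_def)
  define A where "A = (\<lambda>e::'a set. (src e, tgt e)) ` E"
  define A' where "A' = (\<lambda>e::'a set. (tgt e, src e)) ` E"
  have inj: "inj_on (\<lambda>e. (src e, tgt e)) E" "inj_on (\<lambda>e. (tgt e, src e)) E"
    using E(1) by (auto intro!: inj_onI) (metis)+
  have disj: "A \<inter> A' = {}"
  proof (rule ccontr)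
    assume "A \<inter> A' \<noteq> {}"
    then obtain e e' where e: "e \<in> E" "e' \<in> E" and "(src e, tgt e) = (tgt e', src e')"
      unfolding A_def A'_def by blast
    then have eq: "src e = tgt e'" "tgt e = src e'" by (simp_all only: prod.inject)
    then have "e = e'" using E(1)[OF e(1)] E(1)[OF e(2)] by (metis insert_commute)
    then show False using eq(1) E(4)[OF e(2)] by simp
  qed
  have sub: "A \<union> A' \<subseteq> V \<times> V" unfolding A_def A'_def
    using E(2,3) by (intro Un_least image_subsetI) (simp_all add: mem_Times_iff)
  have rest: "{u, v} \<notin> E" if "(u, v) \<in> V \<times> V - (A \<union> A')" for u v
  proof
    assume e: "{u, v} \<in> E"
    then have "{u, v} = {src {u, v}, tgt {u, v}}" using E(1) by blast
    then have "(u, v) = (src {u, v}, tgt {u, v}) \<or> (u, v) = (tgt {u, v}, src {u, v})"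
      by (simp only: doubleton_eq_iff prod.inject)
    then show False using that e unfolding A_def A'_def by blast
  qed
  have "(\<Prod>u\<in>V. \<Prod>v\<in>V. h u v) = (\<Prod>(u, v)\<in>V \<times> V. h u v)" by (simp add: prod.cartesian_product)
  also have "\<dots> = (\<Prod>(u, v)\<in>A \<union> A'. h u v)"
    by (rule prod.mono_neutral_right) (use fin sub rest off in auto)
  also have "\<dots> = (\<Prod>(u, v)\<in>A. h u v) * (\<Prod>(u, v)\<in>A'. h u v)"
    by (rule prod.union_disjoint) (use fin disj in \<open>auto simp: A_def A'_def\<close>)
  also have "\<dots> = (\<Prod>e\<in>E. h (src e) (tgt e)) * (\<Prod>e\<in>E. h (tgt e) (src e))"
    unfolding A_def A'_def prod.reindex[OF inj(1)] prod.reindex[OF inj(2)] o_def prod.case ..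
  also have "(\<Prod>e\<in>E. h (tgt e) (src e)) = (\<Prod>e\<in>E. h (src e) (tgt e))"
    using sym by (intro prod.cong) auto
  finally show ?thesis by (simp add: power2_eq_square)
qed

text \<open>
  The inequality for ferromagnetic two-spin systems: around a maximizer the partition function is
  the Bethe value times the partition function of a normalized system.
\<close>

theorem two_spin_Z_ge_bethe_Z:
  fixes V :: "'a set"
  assumes G: "finite_simple_graph V E"
    and \<psi>: "\<And>s t. 0 < \<psi> s t" and \<psi>': "\<And>s. 0 < \<psi>' s"
    and ferro: "\<psi> Plus Minus * \<psi> Minus Plus \<le> \<psi> Plus Plus * \<psi> Minus Minus"
  shows "bethe_Z V E \<psi> \<psi>' \<le> two_spin_Z V E \<psi> \<psi>'"
proof -
  obtain m n where M: "(m, n) \<in> local_marginals V E"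
    and Z: "bethe_Z V E \<psi> \<psi>' = exp (log_bethe V E \<psi> \<psi>' m n)"
    using bethe_Z_attained(1)[OF G, of \<psi> \<psi>'] by blast
  have max: "bethe_maximizer V E \<psi> \<psi>' m n"
    using M bethe_Z_attained(2)[OF G, of _ _ \<psi> \<psi>'] unfolding Z bethe_maximizer_def by auto
  note E = ends_in_graph[OF G]
  have finV: "finite V" using G by (simp add: finite_simple_graph_def)
  have m_pos: "0 < m v s" if "v \<in> V" for v s using maximizer_vertex_pos[OF G max that] .
  define f where "f = edge_factor m n"
  have f_pos: "0 < f e s t" if "e \<in> E" for e s t
    using maximizer_edge_pos[OF G max that] m_pos E(2,3)[OF that] by (simp add: f_def edge_factor_def)
  have f_src: "(\<Sum>s\<in>UNIV. m (src e) s * f e s t) = 1" and f_tgt: "(\<Sum>t\<in>UNIV. m (tgt e) t * f e s t) = 1"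
    if e: "e \<in> E" for e s t
  proof -
    have "m (src e) s \<noteq> 0" "m (tgt e) s \<noteq> 0" for s using m_pos E(2,3)[OF e] by (metis less_irrefl)+
    then have "(\<Sum>s\<in>UNIV. m (src e) s * f e s t) = (\<Sum>s\<in>UNIV. n e s t) / m (tgt e) t"
      "(\<Sum>t\<in>UNIV. m (tgt e) t * f e s t) = (\<Sum>t\<in>UNIV. n e s t) / m (src e) s"
      by (simp_all add: f_def edge_factor_def sum_divide_distrib)
    moreover have "(\<Sum>s\<in>UNIV. n e s t) = m (tgt e) t" "(\<Sum>t\<in>UNIV. n e s t) = m (src e) s"
      using M e by (auto simp: local_marginals_def)
    ultimately show "(\<Sum>s\<in>UNIV. m (src e) s * f e s t) = 1" "(\<Sum>t\<in>UNIV. m (tgt e) t * f e s t) = 1"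
      using \<open>\<And>s. m (src e) s \<noteq> 0\<close> \<open>\<And>s. m (tgt e) s \<noteq> 0\<close> by simp_all
  qed
  \<comment> \<open>The edge factors as functions of ordered pairs, independent of the naming of the ends.\<close>
  define F where "F = (\<lambda>u v s t. if {u, v} \<in> E
      then if u = src {u, v} then f {u, v} s t else f {u, v} t s else 1)"
  have F_cases: "({u, v} \<notin> E \<and> (\<forall>s t. F u v s t = 1 \<and> F v u t s = 1)) \<or>
      (\<exists>e\<in>E. u = src e \<and> v = tgt e \<and> (\<forall>s t. F u v s t = f e s t \<and> F v u t s = f e s t)) \<or>
      (\<exists>e\<in>E. u = tgt e \<and> v = src e \<and> (\<forall>s t. F u v s t = f e t s \<and> F v u t s = f e t s))" for u v
  proof (cases "{u, v} \<in> E")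
    case True
    define e where "e = {u, v}"
    have e: "e \<in> E" and eq: "{v, u} = e" "{u, v} = e" using True by (auto simp: e_def)
    have "(u = src e \<and> v = tgt e) \<or> (u = tgt e \<and> v = src e)"
      using E(1)[OF e] eq(2) by (metis doubleton_eq_iff)
    then show ?thesis using E(4)[OF e] e unfolding F_def eq by auto
  next
    case False
    then show ?thesis by (simp add: F_def insert_commute)
  qed
  have "normalized_system V m F"
    unfolding normalized_system_def
  proof (intro conjI ballI allI)
    fix v s t assume v: "v \<in> V"
    show "0 < m v s" using m_pos[OF v] .
    show "(\<Sum>s\<in>UNIV. m v s) = 1" using M v by (auto simp: local_marginals_def)
    have "{v, v} \<notin> E" using E(1,4) by (metis doubleton_eq_iff)
    then show "F v v s t = 1" by (simp add: F_def)
  next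
    fix u v s t assume u: "u \<in> V" and v: "v \<in> V"
    show "0 < F u v s t" using F_cases[of u v] f_pos by auto
    show "F u v s t = F v u t s" using F_cases[of u v] by auto
    show "(\<Sum>s\<in>UNIV. m u s * F u v s t) = 1"
      using F_cases[of u v] f_src f_tgt M u by (auto simp: local_marginals_def)
    have "f e Plus Minus * f e Minus Plus \<le> f e Plus Plus * f e Minus Minus" if "e \<in> E" for e
      unfolding f_def using maximizer_edge_determinant[OF G max \<psi> ferro that] .
    then show "F u v Plus Minus * F u v Minus Plus \<le> F u v Plus Plus * F u v Minus Minus"
      using F_cases[of u v] by (auto simp: mult.commute)
  qed
  then have "1 \<le> system_Z V m F" by (rule normalized_system_Z_ge_1[OF finV])
  also have "system_Z V m F = (\<Sum>\<sigma>\<in>V \<rightarrow>\<^sub>E UNIV. (\<Prod>v\<in>V. m v (\<sigma> v)) * (\<Prod>e\<in>E. f e (\<sigma> (src e)) (\<sigma> (tgt e))))"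
    unfolding system_Z_def
  proof (intro sum.cong refl arg_cong2[of _ _ _ _ "(*)"])
    fix \<sigma> :: "'a \<Rightarrow> spin"
    have "(\<Prod>u\<in>V. \<Prod>v\<in>V. F u v (\<sigma> u) (\<sigma> v)) = (\<Prod>e\<in>E. F (src e) (tgt e) (\<sigma> (src e)) (\<sigma> (tgt e)))\<^sup>2"
    proof (rule prod_ordered_pairs[OF G])
      show "F u v (\<sigma> u) (\<sigma> v) = F v u (\<sigma> v) (\<sigma> u)" for u v
        using F_cases[of u v] by (elim disjE bexE conjE) simp_all
      show "F u v (\<sigma> u) (\<sigma> v) = 1" if "{u, v} \<notin> E" for u v using that by (simp add: F_def)
    qed
    also have "(\<Prod>e\<in>E. F (src e) (tgt e) (\<sigma> (src e)) (\<sigma> (tgt e))) = (\<Prod>e\<in>E. f e (\<sigma> (src e)) (\<sigma> (tgt e)))"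
    proof (rule prod.cong[OF refl])
      fix e assume e: "e \<in> E"
      have "{src e, tgt e} = e" using E(1)[OF e] by simp
      then show "F (src e) (tgt e) (\<sigma> (src e)) (\<sigma> (tgt e)) = f e (\<sigma> (src e)) (\<sigma> (tgt e))"
        using e by (simp add: F_def)
    qed
    finally show "sqrt (\<Prod>u\<in>V. \<Prod>v\<in>V. F u v (\<sigma> u) (\<sigma> v)) = (\<Prod>e\<in>E. f e (\<sigma> (src e)) (\<sigma> (tgt e)))"
      using f_pos by (simp add: prod_nonneg less_imp_le)
  qed
  finally have "bethe_Z V E \<psi> \<psi>' * 1 \<le> bethe_Z V E \<psi> \<psi>' *
      (\<Sum>\<sigma>\<in>V \<rightarrow>\<^sub>E UNIV. (\<Prod>v\<in>V. m v (\<sigma> v)) * (\<Prod>e\<in>E. f e (\<sigma> (src e)) (\<sigma> (tgt e))))"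
    by (intro mult_left_mono) (simp_all add: Z)
  also have "\<dots> = two_spin_Z V E \<psi> \<psi>'"
    unfolding two_spin_Z_def maximizer_reparametrization[OF G max \<psi> \<psi>'] Z sum_distrib_left f_def ..
  finally show ?thesis by simp
qed

section \<open>Comparison with the random-cluster partition function\<close>

abbreviation adj :: "'a set set \<Rightarrow> ('a \<times> 'a) set" where
  "adj F \<equiv> {(x, y). {x, y} \<in> F}"

text \<open>The equivalence relation whose classes are the \<open>components\<close>.\<close>

abbreviation same_comp :: "'a set \<Rightarrow> 'a set set \<Rightarrow> ('a \<times> 'a) set" where
  "same_comp V F \<equiv> {(u, v). u \<in> V \<and> v \<in> V \<and> (u, v) \<in> (adj F)\<^sup>*}"

lemma sym_adj: "sym (adj F)"
  by (auto simp: sym_def insert_commute)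

lemma equiv_same_comp: "equiv V (same_comp V F)"
  using sym_rtrancl[OF sym_adj[of F]]
  by (auto simp: equiv_def refl_on_def sym_def trans_def intro: rtrancl_trans)

lemma finite_components: "finite V \<Longrightarrow> finite (components V F)"
  unfolding components_def by (rule finite_quotient) auto

lemma rtrancl_adj_insert:
  assumes "(x, y) \<in> (adj (insert {a, b} F))\<^sup>*"
  shows "(x, y) \<in> (adj F)\<^sup>* \<or> ((x, a) \<in> (adj F)\<^sup>* \<and> (b, y) \<in> (adj F)\<^sup>*)
    \<or> ((x, b) \<in> (adj F)\<^sup>* \<and> (a, y) \<in> (adj F)\<^sup>*)"
  using assms
proof (induction rule: rtrancl_induct)
  case (step y z)
  from step.hyps(2) consider "(y, z) \<in> adj F" | "y = a" "z = b" | "y = b" "z = a"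
    by (auto simp: doubleton_eq_iff)
  then show ?case
  proof cases
    case 1
    then show ?thesis using step.IH by (meson rtrancl.rtrancl_into_rtrancl)
  next
    case 2
    then show ?thesis using step.IH by auto
  next
    case 3
    then show ?thesis using step.IH by auto
  qed
qed simp

lemma card_components_insert:
  assumes fin: "finite V" and a: "a \<in> V"
  shows "card (components V F) \<le> card (components V (insert {a, b} F)) + 1"
proof -
  let ?r = "same_comp V F" and ?r' = "same_comp V (insert {a, b} F)"
  \<comment> \<open>Sends a component to the component of the larger graph that contains it; only the
    components of \<open>a\<close> and \<open>b\<close> can be identified.\<close>
  define g where "g = (\<lambda>X. ?r' `` {SOME x. x \<in> X})"
  have rep: "(SOME x. x \<in> X) \<in> X \<and> X = ?r `` {SOME x. x \<in> X} \<and> (SOME x. x \<in> X) \<in> V"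
    if X: "X \<in> components V F" for X
  proof -
    obtain x where x: "x \<in> V" "X = ?r `` {x}"
      using X unfolding components_def by (rule quotientE)
    then have "x \<in> X" using equiv_class_self[OF equiv_same_comp] by blast
    then have 1: "(SOME x. x \<in> X) \<in> X" by (rule someI)
    moreover from 1 have 2: "(x, SOME x. x \<in> X) \<in> ?r" unfolding x(2) by (rule ImageE) blast
    moreover have "X = ?r `` {SOME x. x \<in> X}"
      using equiv_class_eq[OF equiv_same_comp 2] x(2) by (rule trans[rotated])
    moreover have "(SOME x. x \<in> X) \<in> V" using 2 by blast
    ultimately show ?thesis by blast
  qed
  have "inj_on g (components V F - {?r `` {a}})"
  proof (rule inj_onI)
    fix X Y assume X: "X \<in> components V F - {?r `` {a}}" and Y: "Y \<in> components V F - {?r `` {a}}"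
      and eq: "g X = g Y"
    define x where "x = (SOME x. x \<in> X)"
    define y where "y = (SOME y. y \<in> Y)"
    have x: "x \<in> V" "X = ?r `` {x}" and y: "y \<in> V" "Y = ?r `` {y}"
      using rep X Y by (auto simp: x_def y_def)
    have "(x, y) \<in> ?r'"
      using eq x(1) y(1) eq_equiv_class[OF _ equiv_same_comp] unfolding g_def x_def y_def by blast
    then have "(x, y) \<in> (adj F)\<^sup>* \<or> (x, a) \<in> (adj F)\<^sup>* \<or> (a, y) \<in> (adj F)\<^sup>*"
      using rtrancl_adj_insert[of x y a b F] by blast
    then have "(x, y) \<in> ?r \<or> (x, a) \<in> ?r \<or> (a, y) \<in> ?r" using x y a by blast
    moreover have "(x, a) \<notin> ?r"
      using X x(2) equiv_class_eq[OF equiv_same_comp, of x a V F] by blast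
    moreover have "(a, y) \<notin> ?r"
      using Y y(2) equiv_class_eq[OF equiv_same_comp, of a y V F] by blast
    ultimately have "(x, y) \<in> ?r" by blast
    then show "X = Y" unfolding x(2) y(2) by (rule equiv_class_eq[OF equiv_same_comp])
  qed
  moreover have "g ` (components V F - {?r `` {a}}) \<subseteq> components V (insert {a, b} F)"
  proof (rule image_subsetI)
    fix X assume "X \<in> components V F - {?r `` {a}}"
    then have "(SOME x. x \<in> X) \<in> V" using rep by blast
    then show "g X \<in> components V (insert {a, b} F)"
      unfolding g_def components_def by (rule quotientI)
  qed
  ultimately have "card (components V F - {?r `` {a}}) \<le> card (components V (insert {a, b} F))"
    using finite_components[OF fin] by (intro card_inj_on_le)
  then show ?thesis by (simp add: card_Diff_singleton_if split: if_splits)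
qed

text \<open>A graph has at least as many edges as a spanning forest.\<close>

lemma card_vertices_le:
  assumes "finite V" "finite F" "\<And>e. e \<in> F \<Longrightarrow> \<exists>a b. e = {a, b} \<and> a \<in> V"
  shows "card V \<le> card F + card (components V F)"
  using assms(2,3)
proof (induction F rule: finite_induct)
  case empty
  have "components V {} = (\<lambda>v. {v}) ` V" by (auto simp: components_def quotient_def)
  then show ?case by (simp add: card_image)
next
  case (insert e F)
  obtain a b where "e = {a, b}" "a \<in> V" using insert.prems by blast
  then show ?case using insert card_components_insert[OF assms(1), of a F b] by fastforce
qed

lemma components_closed_subset:
  assumes N: "N \<subseteq> V" and closed: "\<And>x y. {x, y} \<in> F \<Longrightarrow> x \<in> N \<Longrightarrow> y \<in> N"
  shows "components N {e\<in>F. e \<subseteq> N} = {C \<in> components V F. C \<subseteq> N}"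
proof -
  let ?F = "{e\<in>F. e \<subseteq> N}"
  have stay: "y \<in> N \<and> (x, y) \<in> (adj ?F)\<^sup>*" if "(x, y) \<in> (adj F)\<^sup>*" "x \<in> N" for x y
    using that
  proof (induction rule: rtrancl_induct)
    case (step y z)
    then have "z \<in> N" "(y, z) \<in> adj ?F" using closed by auto
    then show ?case using step by (auto intro: rtrancl.rtrancl_into_rtrancl)
  qed simp
  have mono: "(adj ?F)\<^sup>* \<subseteq> (adj F)\<^sup>*" by (rule rtrancl_mono) auto
  have eq: "same_comp N ?F `` {x} = same_comp V F `` {x}" if "x \<in> N" for x
    using stay mono N that by blast
  show ?thesis
  proof
    show "components N ?F \<subseteq> {C \<in> components V F. C \<subseteq> N}"
    proof
      fix C assume "C \<in> components N ?F"
      then obtain x where x: "x \<in> N" "C = same_comp N ?F `` {x}"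
        unfolding components_def by (rule quotientE)
      then have "C \<subseteq> N" by blast
      moreover have "C \<in> components V F"
        unfolding components_def x(2) eq[OF x(1)] using x(1) N by (intro quotientI) auto
      ultimately show "C \<in> {C \<in> components V F. C \<subseteq> N}" by simp
    qed
    show "{C \<in> components V F. C \<subseteq> N} \<subseteq> components N ?F"
    proof
      fix C assume "C \<in> {C \<in> components V F. C \<subseteq> N}"
      then have CN: "C \<subseteq> N" and "C \<in> components V F" by auto
      then obtain x where x: "x \<in> V" "C = same_comp V F `` {x}"
        unfolding components_def by (auto elim: quotientE)
      then have "x \<in> N" using CN by blast
      then show "C \<in> components N ?F"
        unfolding components_def x(2) eq[OF \<open>x \<in> N\<close>, symmetric] by (intro quotientI)
    qed
  qed
qed

lemma Union_components_closed_subset: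
  assumes N: "N \<subseteq> V" and closed: "\<And>x y. {x, y} \<in> F \<Longrightarrow> x \<in> N \<Longrightarrow> y \<in> N"
  shows "\<Union>{C \<in> components V F. C \<subseteq> N} = N"
proof -
  have "\<Union>(components N {e\<in>F. e \<subseteq> N}) = N"
    unfolding components_def by (rule Union_quotient[OF equiv_same_comp])
  moreover have "components N {e\<in>F. e \<subseteq> N} = {C \<in> components V F. C \<subseteq> N}"
    using assms by (rule components_closed_subset)
  ultimately show ?thesis by simp
qed

text \<open>
  The weight of a retained edge in the expansion of the two-spin weights:
  \<open>rc_psi q w s t = 1 + w * mono_weight (q - 1) s t\<close>.
\<close>

fun mono_weight :: "real \<Rightarrow> spin \<Rightarrow> spin \<Rightarrow> real" where
  "mono_weight c Plus Plus = 1"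
| "mono_weight c Minus Minus = 1 / c"
| "mono_weight c _ _ = 0"

text \<open>
  For spins that are constant on the components of \<open>F\<close>, the minus spins fill a union \<open>N\<close> of
  components.  With \<open>c = q - 1\<close> the power of \<open>c\<close> is the number of vertices in \<open>N\<close> minus the number
  of edges inside \<open>N\<close>, which is at most the number of components in \<open>N\<close>.
\<close>

lemma monochromatic_weight_le:
  fixes V :: "'a set" and c b :: real
  assumes G: "finite_simple_graph V F" and c: "1 \<le> c" and b: "0 \<le> b"
    and mono: "\<And>e. e \<in> F \<Longrightarrow> \<sigma> (src e) = \<sigma> (tgt e)"
  defines "N \<equiv> {v \<in> V. \<sigma> v = Minus}"
  shows "(\<Prod>v\<in>V. if \<sigma> v = Minus then c * b else 1) * (\<Prod>e\<in>F. mono_weight c (\<sigma> (src e)) (\<sigma> (tgt e)))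
    \<le> (\<Prod>C\<in>{C \<in> components V F. C \<subseteq> N}. c * b ^ card C)"
proof -
  note E = ends_in_graph[OF G]
  have fin: "finite V" "finite F" using G finite_edges[OF G] by (auto simp: finite_simple_graph_def)
  define FN where "FN = {e\<in>F. e \<subseteq> N}"
  define \<D> where "\<D> = {C \<in> components V F. C \<subseteq> N}"
  have NV: "N \<subseteq> V" and finN: "finite N" and finFN: "finite FN"
    using fin by (auto simp: N_def FN_def)
  have closed: "y \<in> N" if "{x, y} \<in> F" "x \<in> N" for x y
  proof -
    have "{x, y} = {src {x, y}, tgt {x, y}}" using E(1)[OF that(1)] .
    then have "x = src {x, y} \<and> y = tgt {x, y} \<or> x = tgt {x, y} \<and> y = src {x, y}"
      by (simp only: doubleton_eq_iff)
    then have "\<sigma> x = \<sigma> y" "y \<in> V" using mono[OF that(1)] E(2,3)[OF that(1)] by metis+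
    then show ?thesis using that(2) by (simp add: N_def)
  qed
  have comps: "components N FN = \<D>"
    unfolding FN_def \<D>_def using NV closed by (rule components_closed_subset)
  have "card N \<le> card FN + card (components N FN)"
  proof (rule card_vertices_le[OF finN finFN])
    fix e assume "e \<in> FN"
    then have e: "e \<in> F" "e \<subseteq> N" by (auto simp: FN_def)
    have "src e \<in> N" using E(1)[OF e(1)] e(2) by blast
    then show "\<exists>a b. e = {a, b} \<and> a \<in> N" using E(1)[OF e(1)] by blast
  qed
  then have card: "card N \<le> card FN + card \<D>" by (simp add: comps)
  have sum: "card N = (\<Sum>C\<in>\<D>. card C)"
  proof -
    have "card (\<Union>\<D>) = (\<Sum>C\<in>\<D>. card C)"
    proof (rule card_Union_disjoint)
      show "pairwise disjnt \<D>"
        unfolding comps[symmetric] components_def pairwise_def disjnt_def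
        using quotient_disj[OF equiv_same_comp] by blast
      show "finite C" if "C \<in> \<D>" for C using that finN finite_subset by (auto simp: \<D>_def)
    qed
    moreover have "\<Union>\<D> = N" unfolding \<D>_def using NV closed by (rule Union_components_closed_subset)
    ultimately show ?thesis by simp
  qed
  have 1: "(\<Prod>v\<in>V. if \<sigma> v = Minus then c * b else 1) = (c * b) ^ card N"
    using fin(1) by (simp add: prod.If_cases N_def Int_def)
  have 2: "(\<Prod>e\<in>F. mono_weight c (\<sigma> (src e)) (\<sigma> (tgt e))) = (1 / c) ^ card FN"
  proof -
    have "mono_weight c (\<sigma> (src e)) (\<sigma> (tgt e)) = (if e \<in> FN then 1 / c else 1)" if e: "e \<in> F" for e
    proof -
      have "e \<subseteq> N \<longleftrightarrow> src e \<in> N \<and> tgt e \<in> N" using E(1)[OF e] by (metis insert_subset empty_subsetI)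
      then have "e \<in> FN \<longleftrightarrow> \<sigma> (src e) = Minus"
        using mono[OF e] E(2,3)[OF e] e by (auto simp: FN_def N_def)
      then show ?thesis using mono[OF e] by (cases "\<sigma> (src e)") auto
    qed
    then have "(\<Prod>e\<in>F. mono_weight c (\<sigma> (src e)) (\<sigma> (tgt e))) = (\<Prod>e\<in>F. if e \<in> FN then 1 / c else 1)"
      by (rule prod.cong[OF refl])
    also have "\<dots> = (1 / c) ^ card (F \<inter> FN)" using fin(2) by (simp add: prod.If_cases Int_def)
    also have "F \<inter> FN = FN" by (auto simp: FN_def)
    finally show ?thesis .
  qed
  have 3: "(\<Prod>C\<in>\<D>. c * b ^ card C) = c ^ card \<D> * b ^ card N"
    by (simp add: prod.distrib power_sum sum)
  have "c ^ card N \<le> c ^ card \<D> * c ^ card FN"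
    using power_increasing[OF card c] by (simp add: power_add mult.commute)
  then have "c ^ card N * (1 / c) ^ card FN \<le> c ^ card \<D>"
    using c unfolding power_one_over times_divide_eq_right mult_1_right
    by (subst pos_divide_le_eq) auto
  then have "c ^ card N * (1 / c) ^ card FN * b ^ card N \<le> c ^ card \<D> * b ^ card N"
    using b by (intro mult_right_mono) auto
  moreover have "(c * b) ^ card N * (1 / c) ^ card FN = c ^ card N * (1 / c) ^ card FN * b ^ card N"
    by (simp only: power_mult_distrib mult_ac)
  ultimately show ?thesis unfolding 1 2 \<D>_def[symmetric] 3 by (simp only:)
qed

lemma monochromatic_sum_le:
  fixes V :: "'a set" and c b :: real
  assumes G: "finite_simple_graph V F" and c: "1 \<le> c" and b: "0 \<le> b"
  shows "(\<Sum>\<sigma>\<in>V \<rightarrow>\<^sub>E UNIV. (\<Prod>v\<in>V. if \<sigma> v = Minus then c * b else 1)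
      * (\<Prod>e\<in>F. mono_weight c (\<sigma> (src e)) (\<sigma> (tgt e))))
    \<le> (\<Prod>C\<in>components V F. 1 + c * b ^ card C)"
  (is "sum ?w _ \<le> _")
proof -
  note E = ends_in_graph[OF G]
  have fin: "finite V" "finite F" using G finite_edges[OF G] by (auto simp: finite_simple_graph_def)
  have finS: "finite (V \<rightarrow>\<^sub>E (UNIV :: spin set))" using fin by (simp add: finite_PiE)
  define good where "good = {\<sigma> \<in> V \<rightarrow>\<^sub>E (UNIV :: spin set). \<forall>e\<in>F. \<sigma> (src e) = \<sigma> (tgt e)}"
  define N where "N = (\<lambda>\<sigma>. {v \<in> V. \<sigma> v = Minus})"
  define \<D> where "\<D> = (\<lambda>\<sigma>. {C \<in> components V F. C \<subseteq> N \<sigma>})"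
  define h where "h = (\<lambda>\<D>. \<Prod>C\<in>\<D>. c * b ^ card (C :: 'a set))"
  have h0: "0 \<le> h X" for X unfolding h_def using c b by (intro prod_nonneg) auto
  have zero: "?w \<sigma> = 0" if \<sigma>: "\<sigma> \<in> (V \<rightarrow>\<^sub>E UNIV) - good" for \<sigma> :: "'a \<Rightarrow> spin"
  proof -
    obtain e where e: "e \<in> F" "\<sigma> (src e) \<noteq> \<sigma> (tgt e)" using \<sigma> by (auto simp: good_def)
    then have "mono_weight c (\<sigma> (src e)) (\<sigma> (tgt e)) = 0"
      by (cases "\<sigma> (src e)"; cases "\<sigma> (tgt e)") auto
    then have "(\<Prod>e\<in>F. mono_weight c (\<sigma> (src e)) (\<sigma> (tgt e))) = 0"
      using e fin by (meson prod_zero)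
    then show ?thesis by simp
  qed
  have UN: "\<Union>(\<D> \<sigma>) = N \<sigma>" if "\<sigma> \<in> good" for \<sigma>
    unfolding \<D>_def
  proof (rule Union_components_closed_subset)
    show "N \<sigma> \<subseteq> V" by (auto simp: N_def)
    fix x y assume xy: "{x, y} \<in> F" "x \<in> N \<sigma>"
    have "{x, y} = {src {x, y}, tgt {x, y}}" using E(1)[OF xy(1)] .
    then have "x = src {x, y} \<and> y = tgt {x, y} \<or> x = tgt {x, y} \<and> y = src {x, y}"
      by (simp only: doubleton_eq_iff)
    moreover have "\<sigma> (src {x, y}) = \<sigma> (tgt {x, y})" using that xy(1) by (simp add: good_def)
    ultimately have "\<sigma> x = \<sigma> y" "y \<in> V" using E(2,3)[OF xy(1)] by metis+
    then show "y \<in> N \<sigma>" using xy(2) by (simp add: N_def)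
  qed
  \<comment> \<open>Spins constant on components are determined by their set of minus components.\<close>
  have inj: "inj_on \<D> good"
  proof (rule inj_onI)
    fix \<sigma> \<tau> :: "'a \<Rightarrow> spin" assume s: "\<sigma> \<in> good" and t: "\<tau> \<in> good" and "\<D> \<sigma> = \<D> \<tau>"
    then have eq: "N \<sigma> = N \<tau>" using UN by metis
    show "\<sigma> = \<tau>"
    proof (rule PiE_ext)
      show "\<sigma> \<in> V \<rightarrow>\<^sub>E UNIV" "\<tau> \<in> V \<rightarrow>\<^sub>E UNIV" using s t by (auto simp: good_def)
      fix v assume "v \<in> V"
      then have "\<sigma> v = Minus \<longleftrightarrow> \<tau> v = Minus" using eq by (auto simp: N_def)
      then show "\<sigma> v = \<tau> v" by (metis (full_types) spin.exhaust)
    qed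
  qed
  have "sum ?w (V \<rightarrow>\<^sub>E UNIV) = sum ?w good"
    by (rule sum.mono_neutral_right[OF finS]) (use zero in \<open>auto simp: good_def\<close>)
  also have "\<dots> \<le> (\<Sum>\<sigma>\<in>good. h (\<D> \<sigma>))"
    unfolding h_def \<D>_def N_def
    by (intro sum_mono monochromatic_weight_le[OF G c b]) (auto simp: good_def)
  also have "\<dots> = (\<Sum>X\<in>\<D> ` good. h X)" by (simp add: sum.reindex[OF inj])
  also have "\<dots> \<le> (\<Sum>X\<in>Pow (components V F). h X)"
    using finite_components[OF fin(1)] h0 by (intro sum_mono2) (auto simp: \<D>_def)
  also have "\<dots> = (\<Prod>C\<in>components V F. 1 + c * b ^ card C)"
    using prod_add[OF finite_components[OF fin(1)], of "\<lambda>C. c * b ^ card C" "\<lambda>_. 1" F]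
    by (simp add: h_def add.commute)
  finally show ?thesis .
qed

lemma random_cluster_Z_subsets:
  assumes "finite E"
  shows "random_cluster_Z V E q w B =
    (\<Sum>F\<in>Pow E. w ^ card F * (\<Prod>C\<in>components V F. 1 + (q - 1) * exp (- B) ^ card C))"
  unfolding random_cluster_Z_def
proof (rule sum.reindex_bij_witness[of _ "\<lambda>F. \<lambda>e\<in>E. of_bool (e \<in> F)" "\<lambda>\<omega>. {e\<in>E. \<omega> e = 1}"])
  fix \<omega> :: "'a set \<Rightarrow> nat" assume \<omega>: "\<omega> \<in> E \<rightarrow>\<^sub>E {0, 1}"
  show "(\<lambda>e\<in>E. of_bool (e \<in> {e\<in>E. \<omega> e = 1})) = \<omega>"
    using \<omega> by (intro ext) (auto simp: restrict_def PiE_iff extensional_def)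
  have "(\<Prod>e\<in>E. w ^ \<omega> e) = (\<Prod>e\<in>E. if \<omega> e = 1 then w else 1)"
    using \<omega> by (intro prod.cong) (auto simp: PiE_iff)
  also have "\<dots> = w ^ card {e\<in>E. \<omega> e = 1}" using assms by (simp add: prod.If_cases Int_def)
  finally have weight: "(\<Prod>e\<in>E. w ^ \<omega> e) = w ^ card {e\<in>E. \<omega> e = 1}" .
  show "w ^ card {e\<in>E. \<omega> e = 1} * (\<Prod>C\<in>components V {e\<in>E. \<omega> e = 1}. 1 + (q - 1) * exp (- B) ^ card C)
    = (\<Prod>e\<in>E. w ^ \<omega> e) * (\<Prod>C\<in>components V {e\<in>E. \<omega> e = 1}. 1 + (q - 1) * exp (- B * real (card C)))"
    unfolding weight exp_of_nat2_mult ..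
qed (auto simp: restrict_def)

text \<open>
  Expanding every edge factor as \<open>1 + w * mono_weight\<close> compares the two partition functions
  edge set by edge set.
\<close>

theorem two_spin_Z_le_random_cluster_Z:
  fixes V :: "'a set"
  assumes G: "finite_simple_graph V E" and q: "2 \<le> q" and w: "0 \<le> w"
  shows "two_spin_Z V E (rc_psi q w) (rc_psi_vertex q B) \<le> random_cluster_Z V E q w B"
proof -
  have fin: "finite V" "finite E" using G finite_edges[OF G] by (auto simp: finite_simple_graph_def)
  define c where "c = q - 1"
  have c: "1 \<le> c" using q by (simp add: c_def)
  have psi: "rc_psi q w s t = w * mono_weight c s t + 1" for s t
    by (cases s; cases t) (simp_all add: c_def)
  have psi': "rc_psi_vertex q B s = (if s = Minus then c * exp (- B) else 1)" for s
    by (cases s) (simp_all add: c_def)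
  have sub: "finite_simple_graph V F" if "F \<subseteq> E" for F
    using G that by (auto simp: finite_simple_graph_def)
  have "two_spin_Z V E (rc_psi q w) (rc_psi_vertex q B) = (\<Sum>\<sigma>\<in>V \<rightarrow>\<^sub>E UNIV. \<Sum>F\<in>Pow E.
      w ^ card F * ((\<Prod>v\<in>V. if \<sigma> v = Minus then c * exp (- B) else 1)
        * (\<Prod>e\<in>F. mono_weight c (\<sigma> (src e)) (\<sigma> (tgt e)))))"
    unfolding two_spin_Z_def psi psi' prod_add[OF fin(2)]
    by (simp add: prod.distrib sum_distrib_left mult_ac)
  also have "\<dots> = (\<Sum>F\<in>Pow E. w ^ card F * (\<Sum>\<sigma>\<in>V \<rightarrow>\<^sub>E UNIV.
      (\<Prod>v\<in>V. if \<sigma> v = Minus then c * exp (- B) else 1)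
        * (\<Prod>e\<in>F. mono_weight c (\<sigma> (src e)) (\<sigma> (tgt e)))))"
    unfolding sum_distrib_left by (rule sum.swap)
  also have "\<dots> \<le> (\<Sum>F\<in>Pow E. w ^ card F * (\<Prod>C\<in>components V F. 1 + c * exp (- B) ^ card C))"
    using w c by (intro sum_mono mult_left_mono monochromatic_sum_le) (auto intro: sub)
  also have "\<dots> = random_cluster_Z V E q w B"
    unfolding random_cluster_Z_subsets[OF fin(2)] c_def ..
  finally show ?thesis .
qed

section \<open>Bethe lower bounds\<close>

theorem corollary1p10:
  fixes V :: "'a set" and E :: "'a set set"
  assumes "finite_simple_graph V E"
  shows "(\<forall>(\<psi> :: spin \<Rightarrow> spin \<Rightarrow> real) (\<psi>' :: spin \<Rightarrow> real).
            (\<forall>s t. \<psi> s t > 0) \<and> (\<forall>s t. \<psi> s t = \<psi> t s) \<and> (\<forall>s. \<psi>' s > 0) \<and>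
            \<psi> Plus Plus * \<psi> Minus Minus / (\<psi> Plus Minus)\<^sup>2 \<ge> 1
            \<longrightarrow> two_spin_Z V E \<psi> \<psi>' \<ge> bethe_Z V E \<psi> \<psi>')
       \<and> (\<forall>(q::real) (w::real) (B::real). q \<ge> 2 \<and> w \<ge> 0 \<and> B \<ge> 0
            \<longrightarrow> random_cluster_Z V E q w B \<ge> bethe_Z V E (rc_psi q w) (rc_psi_vertex q B))"
proof (intro conjI allI impI; (elim conjE)?)
  fix \<psi> :: "spin \<Rightarrow> spin \<Rightarrow> real" and \<psi>' :: "spin \<Rightarrow> real"
  assume pos: "\<forall>s t. 0 < \<psi> s t" "\<forall>s. 0 < \<psi>' s" and sym: "\<forall>s t. \<psi> s t = \<psi> t s"
    and ferro: "1 \<le> \<psi> Plus Plus * \<psi> Minus Minus / (\<psi> Plus Minus)\<^sup>2"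
  have "0 < \<psi> Plus Minus" using pos(1) by blast
  then have "(\<psi> Plus Minus)\<^sup>2 \<le> \<psi> Plus Plus * \<psi> Minus Minus"
    using ferro by (simp only: le_divide_eq_1_pos zero_less_power)
  moreover have "\<psi> Minus Plus = \<psi> Plus Minus" using sym by blast
  ultimately have "\<psi> Plus Minus * \<psi> Minus Plus \<le> \<psi> Plus Plus * \<psi> Minus Minus"
    by (simp add: power2_eq_square)
  then show "bethe_Z V E \<psi> \<psi>' \<le> two_spin_Z V E \<psi> \<psi>'"
    using two_spin_Z_ge_bethe_Z[OF assms, of \<psi> \<psi>'] pos by blast
next
  fix q w B :: real
  assume q: "2 \<le> q" and w: "0 \<le> w" and "0 \<le> B"
  have pos: "0 < rc_psi q w s t" "0 < rc_psi_vertex q B s" for s t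
    using q w by (cases s; cases t; simp add: add_pos_nonneg)+
  have "1 * 1 \<le> (1 + w) * (1 + w / (q - 1))"
    using q w by (intro mult_mono) auto
  then have "bethe_Z V E (rc_psi q w) (rc_psi_vertex q B)
      \<le> two_spin_Z V E (rc_psi q w) (rc_psi_vertex q B)"
    by (intro two_spin_Z_ge_bethe_Z[OF assms] pos) simp
  also have "\<dots> \<le> random_cluster_Z V E q w B"
    using assms q w by (rule two_spin_Z_le_random_cluster_Z)
  finally show "bethe_Z V E (rc_psi q w) (rc_psi_vertex q B) \<le> random_cluster_Z V E q w B" .
qed

end
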